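(* Let $p$ be a prime number and let $(a_k)_{k \geq 0}$ be an increasing sequence of non-negative integers with $a_0 = 0$ and $a_{k+1} \ge 2 a_k$ for every sufficiently large integer $k$. Define the $p$-adic number $$\xi=\sum_{k=0}^{\infty} p^{a_{k}} = 1 + p^{a_1} + p^{a_2} + \cdots,$$ and set $$c=\liminf_{k \to\infty} \frac{a_{k+1}}{a_{k}}, \qquad d = \limsup_{k \to\infty}\frac{a_{k+1}}{a_{k}},$$ where $c, d \in [2, + \infty]$. Then $$\mu(\xi)= d, \qquad \mu^{\times}(\xi)= 2 d,$$ and $$3-\frac{1}{c} \;\leq\; \widehat{\mu}^{\times}(\xi) \;\leq\; 3+\frac{1}{d-1},$$ with the conventions $1/\infty = 0$ and $2\cdot\infty=\infty$.
   Context: $\mathbb{Q}_p$ is the field of $p$-adic numbers with absolute value $|\cdot|_p$ normalized by $|p|_p = p^{-1}$. For an irrational $p$-adic number $\xi$: the irrationality exponent $\mu(\xi)$ is the supremum of the real numbers $\mu$ for which $0 < |y\xi - x|_p \le \max\{|x|,|y|\}^{-\mu}$ has infinitely many solutions in nonzero integers $x,y$; the multiplicative irrationality exponent $\mu^{\times}(\xi)$ is the supremum of the real numbers $\mu^\times$ for which $0 < |y\xi - x|_p \le (|xy|^{1/2})^{-\mu^\times}$ has infinitely many solutions in nonzero integers $x,y$; the uniform multiplicative irrationality exponent $\widehat{\mu}^{\times}(\xi)$ is the supremum of the real numbers $\widehat{\mu}^\times$ such that for every sufficiently large real $X$ the system $0 < |xy|^{1/2} \le X$, $|y\xi - x|_p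 \le X^{-\widehat{\mu}^\times}$ has a solution in integers $x,y$ (not required to be coprime). *)

theory Defs
  imports "HOL-Analysis.Analysis" "HOL-Algebra.QuotRing" "HOL-Computational_Algebra.Primes"
begin

section \<open>The field of p-adic numbers\<close>

definition padic_abs_rat :: "nat \<Rightarrow> rat \<Rightarrow> real" where
  "padic_abs_rat p x = (if x = 0 then 0
     else real p powi (int (multiplicity (int p) (snd (quotient_of x)))
                       - int (multiplicity (int p) (fst (quotient_of x)))))"

text \<open>
  The field of p-adic numbers is the completion of the rationals: the ring of rational sequences
  that are Cauchy for the p-adic absolute value, modulo the ideal of null sequences. Its elements
  are thus cosets, that is, sets of rational sequences.
\<close>

definition padic_Cauchy_ring :: "nat \<Rightarrow> (nat \<Rightarrow> rat) ring" where
  "padic_Cauchy_ring p =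
     \<lparr>carrier = {s. \<forall>e>0. \<exists>N. \<forall>m\<ge>N. \<forall>n\<ge>N. padic_abs_rat p (s m - s n) < e},
      mult = (\<lambda>s t n. s n * t n), one = (\<lambda>_. 1), zero = (\<lambda>_. 0), add = (\<lambda>s t n. s n + t n)\<rparr>"

definition padic_null :: "nat \<Rightarrow> (nat \<Rightarrow> rat) set" where
  "padic_null p = {s. (\<lambda>n. padic_abs_rat p (s n)) \<longlonglongrightarrow> 0}"

definition padic_field :: "nat \<Rightarrow> (nat \<Rightarrow> rat) set ring" where
  "padic_field p = padic_Cauchy_ring p Quot padic_null p"

text \<open>The limit does not depend on the choice of the representative; see \<open>padic_abs_tendsto\<close>.\<close>

definition padic_abs :: "nat \<Rightarrow> (nat \<Rightarrow> rat) set \<Rightarrow> real" where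
  "padic_abs p z = lim (\<lambda>n. padic_abs_rat p ((SOME s. s \<in> z) n))"

definition padic_of_rat :: "nat \<Rightarrow> rat \<Rightarrow> (nat \<Rightarrow> rat) set" where
  "padic_of_rat p q = padic_null p +>\<^bsub>padic_Cauchy_ring p\<^esub> (\<lambda>_. q)"

definition padic_sums :: "nat \<Rightarrow> (nat \<Rightarrow> (nat \<Rightarrow> rat) set) \<Rightarrow> (nat \<Rightarrow> rat) set \<Rightarrow> bool" where
  "padic_sums p f z \<longleftrightarrow> z \<in> carrier (padic_field p) \<and>
     (\<lambda>n. padic_abs p (z \<ominus>\<^bsub>padic_field p\<^esub> (\<Oplus>\<^bsub>padic_field p\<^esub>k\<in>{..<n}. f k))) \<longlonglongrightarrow> 0"

definition padic_suminf :: "nat \<Rightarrow> (nat \<Rightarrow> (nat \<Rightarrow> rat) set) \<Rightarrow> (nat \<Rightarrow> rat) set" where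
  "padic_suminf p f = (THE z. padic_sums p f z)"


section \<open>Irrationality exponents\<close>

definition padic_lin_form :: "nat \<Rightarrow> (nat \<Rightarrow> rat) set \<Rightarrow> int \<Rightarrow> int \<Rightarrow> real" where
  "padic_lin_form p z x y =
     padic_abs p (padic_of_rat p (of_int y) \<otimes>\<^bsub>padic_field p\<^esub> z
                  \<ominus>\<^bsub>padic_field p\<^esub> padic_of_rat p (of_int x))"

text \<open>
  All three exponents are meant for irrational arguments. The suprema are taken in the extended
  reals, so that an unbounded set of exponents has supremum \<open>\<infinity>\<close>.
\<close>

definition irrationality_exponent :: "nat \<Rightarrow> (nat \<Rightarrow> rat) set \<Rightarrow> ereal" where
  "irrationality_exponent p z = Sup {ereal \<mu> | \<mu> :: real.
     infinite {(x :: int, y :: int). x \<noteq> 0 \<and> y \<noteq> 0 \<and>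
       0 < padic_lin_form p z x y \<and>
       padic_lin_form p z x y \<le> real_of_int (max \<bar>x\<bar> \<bar>y\<bar>) powr (- \<mu>)}}"

definition mult_irrationality_exponent :: "nat \<Rightarrow> (nat \<Rightarrow> rat) set \<Rightarrow> ereal" where
  "mult_irrationality_exponent p z = Sup {ereal \<mu> | \<mu> :: real.
     infinite {(x :: int, y :: int). x \<noteq> 0 \<and> y \<noteq> 0 \<and>
       0 < padic_lin_form p z x y \<and>
       padic_lin_form p z x y \<le> sqrt (real_of_int \<bar>x * y\<bar>) powr (- \<mu>)}}"

definition unif_mult_irrationality_exponent :: "nat \<Rightarrow> (nat \<Rightarrow> rat) set \<Rightarrow> ereal" where
  "unif_mult_irrationality_exponent p z = Sup {ereal \<mu> | \<mu> :: real.
     \<forall>\<^sub>F X :: real in at_top. \<exists>x y :: int.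
       0 < sqrt (real_of_int \<bar>x * y\<bar>) \<and> sqrt (real_of_int \<bar>x * y\<bar>) \<le> X \<and>
       padic_lin_form p z x y \<le> X powr (- \<mu>)}"


section \<open>Basic facts\<close>

lemma padic_abs_rat_0 [simp]: "padic_abs_rat p 0 = 0"
  by (simp add: padic_abs_rat_def)

lemma padic_abs_rat_nonneg [simp]: "padic_abs_rat p x \<ge> 0"
  by (simp add: padic_abs_rat_def)

lemma padic_abs_rat_eq_0_iff: "prime p \<Longrightarrow> padic_abs_rat p x = 0 \<longleftrightarrow> x = 0"
  using prime_gt_0_nat[of p] by (simp add: padic_abs_rat_def power_int_def)

lemma padic_abs_rat_divide:
  assumes p: "prime p" and "a \<noteq> 0" "b \<noteq> 0"
  shows "padic_abs_rat p (of_int a / of_int b) =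
     real p powi (int (multiplicity (int p) b) - int (multiplicity (int p) a))"
proof -
  obtain c d where cd: "quotient_of (of_int a / of_int b) = (c, d)" by force
  have d0: "d > 0" using quotient_of_denom_pos[OF cd] .
  have eq: "of_int a / of_int b = (of_int c / of_int d :: rat)" using quotient_of_div[OF cd] .
  have c0: "c \<noteq> 0" using eq assms d0 by auto
  have "(of_int (a * d) :: rat) = of_int (c * b)" using eq d0 assms by (simp add: field_simps)
  hence "a * d = c * b" by (simp only: of_int_eq_iff)
  moreover have pe: "prime_elem (int p)" using p by simp
  ultimately have "multiplicity (int p) a + multiplicity (int p) d
      = multiplicity (int p) c + multiplicity (int p) b"
    using prime_elem_multiplicity_mult_distrib[OF pe, of a d]
      prime_elem_multiplicity_mult_distrib[OF pe, of c b] assms d0 c0 by auto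
  hence "int (multiplicity (int p) d) - int (multiplicity (int p) c) =
      int (multiplicity (int p) b) - int (multiplicity (int p) a)" by linarith
  thus ?thesis using assms by (simp add: padic_abs_rat_def cd)
qed

lemma rat_as_quotient:
  obtains a b where "(x :: rat) = of_int a / of_int b" "b \<noteq> 0"
  by (metis quotient_of_div quotient_of_denom_pos surj_pair order_less_irrefl)

lemma padic_abs_rat_mult:
  assumes p: "prime p"
  shows "padic_abs_rat p (x * y) = padic_abs_rat p x * padic_abs_rat p y"
proof (cases "x = 0 \<or> y = 0")
  case False
  obtain a b where x: "x = of_int a / of_int b" "b \<noteq> 0" by (rule rat_as_quotient)
  obtain c d where y: "y = of_int c / of_int d" "d \<noteq> 0" by (rule rat_as_quotient)
  have nz: "a \<noteq> 0" "c \<noteq> 0" using False x y by auto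
  have xy: "x * y = of_int (a * c) / of_int (b * d)" by (simp add: x y)
  have pe: "prime_elem (int p)" using p by simp
  show ?thesis
    unfolding xy using x y nz p prime_gt_0_nat[OF p]
    by (simp add: padic_abs_rat_divide prime_elem_multiplicity_mult_distrib[OF pe]
        power_int_add[symmetric] algebra_simps del: of_int_mult)
qed auto

lemma padic_abs_rat_minus: "prime p \<Longrightarrow> padic_abs_rat p (- x) = padic_abs_rat p x"
  using padic_abs_rat_mult[of p "-1" x] by (simp add: padic_abs_rat_def multiplicity_unit_right)

lemma padic_abs_rat_minus_commute:
  "prime p \<Longrightarrow> padic_abs_rat p (x - y) = padic_abs_rat p (y - x)"
  using padic_abs_rat_minus[of p "x - y"] by simp

lemma padic_abs_rat_1 [simp]: "padic_abs_rat p 1 = 1"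
  by (simp add: padic_abs_rat_def)

lemma padic_abs_rat_self: "prime p \<Longrightarrow> padic_abs_rat p (of_nat p) = 1 / real p"
  using prime_gt_0_nat[of p] by (simp add: padic_abs_rat_def power_int_minus field_simps)

lemma padic_abs_rat_inverse:
  assumes p: "prime p"
  shows "padic_abs_rat p (inverse x) = inverse (padic_abs_rat p x)"
proof (cases "x = 0")
  case False
  have "padic_abs_rat p x * padic_abs_rat p (inverse x) = 1"
    using False by (simp flip: padic_abs_rat_mult[OF p])
  thus ?thesis by (metis inverse_unique)
qed simp

lemma padic_abs_rat_add_le:
  assumes p: "prime p"
  shows "padic_abs_rat p (x + y) \<le> max (padic_abs_rat p x) (padic_abs_rat p y)"
proof (cases "x = 0 \<or> y = 0 \<or> x + y = 0")
  case False
  obtain a b where x: "x = of_int a / of_int b" "b \<noteq> 0" by (rule rat_as_quotient)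
  obtain c d where y: "y = of_int c / of_int d" "d \<noteq> 0" by (rule rat_as_quotient)
  define A B D where "A = a * d" and "B = c * b" and "D = b * d"
  have D: "D \<noteq> 0" using x y by (simp add: D_def)
  have xx: "x = of_int A / of_int D" and yy: "y = of_int B / of_int D"
    and xy: "x + y = of_int (A + B) / of_int D"
    using x y by (simp_all add: A_def B_def D_def field_simps)
  have nz: "A \<noteq> 0" "B \<noteq> 0" "A + B \<noteq> 0" using False xx yy xy by auto
  define k where "k = min (multiplicity (int p) A) (multiplicity (int p) B)"
  have "int p ^ k dvd A + B"
    by (intro dvd_add) (simp_all add: k_def multiplicity_dvd')
  hence k: "k \<le> multiplicity (int p) (A + B)"
    using nz p by (intro multiplicity_geI) auto
  have p1: "real p \<ge> 1" using prime_ge_1_nat[OF p] by simp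
  have "padic_abs_rat p (x + y) \<le> real p powi (int (multiplicity (int p) D) - int k)"
    unfolding xy padic_abs_rat_divide[OF p nz(3) D]
    by (rule power_int_increasing) (use p1 k in auto)
  also have "\<dots> \<le> max (padic_abs_rat p x) (padic_abs_rat p y)"
    unfolding xx yy padic_abs_rat_divide[OF p nz(1) D] padic_abs_rat_divide[OF p nz(2) D]
    by (simp add: k_def min_def)
  finally show ?thesis .
qed (auto simp: max_def)

lemma padic_abs_rat_triangle:
  assumes p: "prime p"
  shows "padic_abs_rat p (x + y) \<le> padic_abs_rat p x + padic_abs_rat p y"
  using padic_abs_rat_add_le[OF p, of x y] padic_abs_rat_nonneg[of p x] padic_abs_rat_nonneg[of p y]
  by linarith

lemma padic_abs_rat_triangle3:
  assumes p: "prime p"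
  shows "\<bar>padic_abs_rat p x - padic_abs_rat p y\<bar> \<le> padic_abs_rat p (x - y)"
  using padic_abs_rat_triangle[OF p, of "x - y" y] padic_abs_rat_triangle[OF p, of "y - x" x]
    padic_abs_rat_minus_commute[OF p, of x y] by simp

lemma padic_Cauchy_ring_simps [simp]:
  "mult (padic_Cauchy_ring p) = (\<lambda>s t n. s n * t n)"
  "add (padic_Cauchy_ring p) = (\<lambda>s t n. s n + t n)"
  "one (padic_Cauchy_ring p) = (\<lambda>_. 1)"
  "zero (padic_Cauchy_ring p) = (\<lambda>_. 0)"
  by (simp_all add: padic_Cauchy_ring_def)

lemma padic_Cauchy_iff:
  "s \<in> carrier (padic_Cauchy_ring p) \<longleftrightarrow>
     (\<forall>e>0. \<exists>N. \<forall>m\<ge>N. \<forall>n\<ge>N. padic_abs_rat p (s m - s n) < e)"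
  by (simp add: padic_Cauchy_ring_def)

lemma padic_Cauchy_convergent:
  assumes p: "prime p" and s: "s \<in> carrier (padic_Cauchy_ring p)"
  shows "convergent (\<lambda>n. padic_abs_rat p (s n))"
proof -
  have "Cauchy (\<lambda>n. padic_abs_rat p (s n))"
  proof (rule metric_CauchyI)
    fix e :: real assume "e > 0"
    then obtain N where N: "\<forall>m\<ge>N. \<forall>n\<ge>N. padic_abs_rat p (s m - s n) < e"
      using s by (auto simp: padic_Cauchy_iff)
    have "dist (padic_abs_rat p (s m)) (padic_abs_rat p (s n)) < e" if "m \<ge> N" "n \<ge> N" for m n
      using padic_abs_rat_triangle3[OF p, of "s m" "s n"] N that
      by (simp add: dist_real_def) (meson le_less_trans)
    thus "\<exists>N. \<forall>m\<ge>N. \<forall>n\<ge>N. dist (padic_abs_rat p (s m)) (padic_abs_rat p (s n)) < e" by blast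
  qed
  thus ?thesis by (simp add: Cauchy_convergent_iff)
qed

lemma padic_Cauchy_bounded:
  assumes p: "prime p" and s: "s \<in> carrier (padic_Cauchy_ring p)"
  obtains B where "B > 0" "\<And>n. padic_abs_rat p (s n) \<le> B"
proof -
  have "Bseq (\<lambda>n. padic_abs_rat p (s n))"
    using padic_Cauchy_convergent[OF p s] by (rule convergent_imp_Bseq)
  thus ?thesis using that by (auto simp: Bseq_def)
qed

lemma padic_Cauchy_const: "(\<lambda>_. q) \<in> carrier (padic_Cauchy_ring p)"
  by (simp add: padic_Cauchy_iff)

lemma padic_Cauchy_add:
  assumes p: "prime p" and s: "s \<in> carrier (padic_Cauchy_ring p)"
    and t: "t \<in> carrier (padic_Cauchy_ring p)"
  shows "(\<lambda>n. s n + t n) \<in> carrier (padic_Cauchy_ring p)"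
  unfolding padic_Cauchy_iff
proof (intro allI impI)
  fix e :: real assume e: "e > 0"
  obtain N where N: "\<forall>m\<ge>N. \<forall>n\<ge>N. padic_abs_rat p (s m - s n) < e"
    using s e by (auto simp: padic_Cauchy_iff)
  obtain M where M: "\<forall>m\<ge>M. \<forall>n\<ge>M. padic_abs_rat p (t m - t n) < e"
    using t e by (auto simp: padic_Cauchy_iff)
  have "padic_abs_rat p (s m + t m - (s n + t n)) < e" if "m \<ge> max N M" "n \<ge> max N M" for m n
  proof -
    have "padic_abs_rat p (s m + t m - (s n + t n)) = padic_abs_rat p ((s m - s n) + (t m - t n))"
      by (simp add: algebra_simps)
    also have "\<dots> \<le> max (padic_abs_rat p (s m - s n)) (padic_abs_rat p (t m - t n))"
      by (rule padic_abs_rat_add_le[OF p])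
    also have "\<dots> < e" using N M that by simp
    finally show ?thesis .
  qed
  thus "\<exists>N. \<forall>m\<ge>N. \<forall>n\<ge>N. padic_abs_rat p (s m + t m - (s n + t n)) < e" by blast
qed

lemma padic_Cauchy_mult:
  assumes p: "prime p" and s: "s \<in> carrier (padic_Cauchy_ring p)"
    and t: "t \<in> carrier (padic_Cauchy_ring p)"
  shows "(\<lambda>n. s n * t n) \<in> carrier (padic_Cauchy_ring p)"
  unfolding padic_Cauchy_iff
proof (intro allI impI)
  fix e :: real assume e: "e > 0"
  obtain A where A: "A > 0" "\<And>n. padic_abs_rat p (s n) \<le> A" using padic_Cauchy_bounded[OF p s] by blast
  obtain B where B: "B > 0" "\<And>n. padic_abs_rat p (t n) \<le> B" using padic_Cauchy_bounded[OF p t] by blast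
  obtain N where N: "\<forall>m\<ge>N. \<forall>n\<ge>N. padic_abs_rat p (s m - s n) < e / B"
    using s divide_pos_pos[OF e B(1)] by (auto simp: padic_Cauchy_iff)
  obtain M where M: "\<forall>m\<ge>M. \<forall>n\<ge>M. padic_abs_rat p (t m - t n) < e / A"
    using t divide_pos_pos[OF e A(1)] by (auto simp: padic_Cauchy_iff)
  have "padic_abs_rat p (s m * t m - s n * t n) < e" if mn: "m \<ge> max N M" "n \<ge> max N M" for m n
  proof -
    have "padic_abs_rat p (s m * t m - s n * t n) =
        padic_abs_rat p ((s m - s n) * t m + s n * (t m - t n))"
      by (simp add: algebra_simps)
    also have "\<dots> \<le> max (padic_abs_rat p ((s m - s n) * t m)) (padic_abs_rat p (s n * (t m - t n)))"
      by (rule padic_abs_rat_add_le[OF p])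
    also have "\<dots> < e"
    proof -
      have "padic_abs_rat p (s m - s n) * padic_abs_rat p (t m) \<le> padic_abs_rat p (s m - s n) * B"
        by (rule mult_left_mono) (use B in auto)
      also have "\<dots> < e / B * B"
        by (rule mult_strict_right_mono) (use N B mn in auto)
      finally have 1: "padic_abs_rat p (s m - s n) * padic_abs_rat p (t m) < e" using B by simp
      have "padic_abs_rat p (s n) * padic_abs_rat p (t m - t n) \<le> A * padic_abs_rat p (t m - t n)"
        by (rule mult_right_mono) (use A in auto)
      also have "\<dots> < A * (e / A)"
        by (rule mult_strict_left_mono) (use M A mn in auto)
      finally have 2: "padic_abs_rat p (s n) * padic_abs_rat p (t m - t n) < e" using A by simp
      show ?thesis using 1 2 by (simp add: padic_abs_rat_mult[OF p])
    qed
    finally show ?thesis .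
  qed
  thus "\<exists>N. \<forall>m\<ge>N. \<forall>n\<ge>N. padic_abs_rat p (s m * t m - s n * t n) < e" by blast
qed

lemma padic_Cauchy_uminus:
  assumes p: "prime p" and s: "s \<in> carrier (padic_Cauchy_ring p)"
  shows "(\<lambda>n. - s n) \<in> carrier (padic_Cauchy_ring p)"
  using padic_Cauchy_mult[OF p padic_Cauchy_const[of "-1"] s] by simp

lemma padic_Cauchy_ring_cring:
  assumes p: "prime p"
  shows "cring (padic_Cauchy_ring p)"
proof (rule cringI)
  show "abelian_group (padic_Cauchy_ring p)"
  proof (rule abelian_groupI)
    fix s assume "s \<in> carrier (padic_Cauchy_ring p)"
    thus "\<exists>y\<in>carrier (padic_Cauchy_ring p). y \<oplus>\<^bsub>padic_Cauchy_ring p\<^esub> s = \<zero>\<^bsub>padic_Cauchy_ring p\<^esub>"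
      using padic_Cauchy_uminus[OF p] by force
  qed (use padic_Cauchy_add[OF p] in \<open>auto simp: padic_Cauchy_const algebra_simps\<close>)
  show "Group.comm_monoid (padic_Cauchy_ring p)"
    by (rule comm_monoidI)
      (use padic_Cauchy_mult[OF p] in \<open>auto simp: padic_Cauchy_const algebra_simps\<close>)
qed (auto simp: algebra_simps)

lemma padic_Cauchy_ring_a_inv [simp]:
  assumes p: "prime p" and s: "s \<in> carrier (padic_Cauchy_ring p)"
  shows "\<ominus>\<^bsub>padic_Cauchy_ring p\<^esub> s = (\<lambda>n. - s n)"
proof -
  interpret cring "padic_Cauchy_ring p" by (rule padic_Cauchy_ring_cring[OF p])
  show ?thesis
    by (rule minus_equality) (use s padic_Cauchy_uminus[OF p s] in auto)
qed

lemma padic_null_subset: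
  assumes p: "prime p"
  shows "padic_null p \<subseteq> carrier (padic_Cauchy_ring p)"
proof
  fix s assume "s \<in> padic_null p"
  hence s: "(\<lambda>n. padic_abs_rat p (s n)) \<longlonglongrightarrow> 0" by (simp add: padic_null_def)
  show "s \<in> carrier (padic_Cauchy_ring p)"
    unfolding padic_Cauchy_iff
  proof (intro allI impI)
    fix e :: real assume "e > 0"
    then obtain N where N: "\<And>n. n \<ge> N \<Longrightarrow> padic_abs_rat p (s n) < e"
      using order_tendstoD(2)[OF s] by (auto simp: eventually_sequentially)
    have "padic_abs_rat p (s m - s n) < e" if "m \<ge> N" "n \<ge> N" for m n
      using padic_abs_rat_add_le[OF p, of "s m" "- s n"] N[of m] N[of n] that
      by (simp add: padic_abs_rat_minus[OF p])
    thus "\<exists>N. \<forall>m\<ge>N. \<forall>n\<ge>N. padic_abs_rat p (s m - s n) < e" by blast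
  qed
qed

lemma padic_null_add:
  assumes p: "prime p" and "s \<in> padic_null p" "t \<in> padic_null p"
  shows "(\<lambda>n. s n + t n) \<in> padic_null p"
proof -
  have "(\<lambda>n. padic_abs_rat p (s n) + padic_abs_rat p (t n)) \<longlonglongrightarrow> 0"
    using assms by (auto simp: padic_null_def intro!: tendsto_eq_intros)
  hence "(\<lambda>n. padic_abs_rat p (s n + t n)) \<longlonglongrightarrow> 0"
    by (rule Lim_null_comparison[rotated]) (use padic_abs_rat_triangle[OF p] in auto)
  thus ?thesis by (simp add: padic_null_def)
qed

lemma padic_null_mult:
  assumes p: "prime p" and "s \<in> padic_null p" "t \<in> carrier (padic_Cauchy_ring p)"
  shows "(\<lambda>n. t n * s n) \<in> padic_null p"
proof -
  obtain B where B: "B > 0" "\<And>n. padic_abs_rat p (t n) \<le> B" using padic_Cauchy_bounded[OF p assms(3)] by blast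
  have "(\<lambda>n. B * padic_abs_rat p (s n)) \<longlonglongrightarrow> 0"
    using assms by (auto simp: padic_null_def intro!: tendsto_eq_intros)
  hence "(\<lambda>n. padic_abs_rat p (t n * s n)) \<longlonglongrightarrow> 0"
    by (rule Lim_null_comparison[rotated])
      (use B in \<open>auto simp: padic_abs_rat_mult[OF p] intro!: always_eventually mult_right_mono\<close>)
  thus ?thesis by (simp add: padic_null_def)
qed

lemma padic_null_ideal:
  assumes p: "prime p"
  shows "ideal (padic_null p) (padic_Cauchy_ring p)"
proof -
  interpret cring "padic_Cauchy_ring p" by (rule padic_Cauchy_ring_cring[OF p])
  have neg: "(\<lambda>n. - s n) \<in> padic_null p" if "s \<in> padic_null p" for s
    using that by (simp add: padic_null_def padic_abs_rat_minus[OF p])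
  show ?thesis
  proof (rule idealI)
    show "subgroup (padic_null p) (add_monoid (padic_Cauchy_ring p))"
    proof (rule add.subgroupI)
      show "padic_null p \<noteq> {}" by (auto simp: padic_null_def intro: exI[of _ "\<lambda>_. 0"])
      show "\<ominus>\<^bsub>padic_Cauchy_ring p\<^esub> s \<in> padic_null p" if "s \<in> padic_null p" for s
        using that padic_null_subset[OF p] neg by (auto simp: p)
    qed (use padic_null_subset[OF p] padic_null_add[OF p] in auto)
  qed (use padic_null_mult[OF p] ring_axioms in \<open>auto simp: mult.commute\<close>)
qed

lemma padic_not_null_bounded_below:
  assumes p: "prime p" and s: "s \<in> carrier (padic_Cauchy_ring p)" "s \<notin> padic_null p"
  obtains c N where "c > 0" "\<And>n. n \<ge> N \<Longrightarrow> padic_abs_rat p (s n) > c"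
proof -
  obtain L where L: "(\<lambda>n. padic_abs_rat p (s n)) \<longlonglongrightarrow> L"
    using padic_Cauchy_convergent[OF p s(1)] by (auto simp: convergent_def)
  have "L \<ge> 0" by (rule LIMSEQ_le_const[OF L]) auto
  moreover have "L \<noteq> 0" using L s(2) by (auto simp: padic_null_def)
  ultimately have "L / 2 < L" "L / 2 > 0" by auto
  with order_tendstoD(1)[OF L, of "L / 2"] that[of "L/2"] show ?thesis
    by (auto simp: eventually_sequentially)
qed

lemma padic_Cauchy_inverse:
  assumes p: "prime p" and s: "s \<in> carrier (padic_Cauchy_ring p)" "s \<notin> padic_null p"
  shows "(\<lambda>n. inverse (s n)) \<in> carrier (padic_Cauchy_ring p)"
  unfolding padic_Cauchy_iff
proof (intro allI impI)
  fix e :: real assume e: "e > 0"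
  obtain c N where c: "c > 0" "\<And>n. n \<ge> N \<Longrightarrow> padic_abs_rat p (s n) > c"
    using padic_not_null_bounded_below[OF p s] by blast
  obtain M where M: "\<forall>m\<ge>M. \<forall>n\<ge>M. padic_abs_rat p (s m - s n) < e * (c * c)"
    using s(1) mult_pos_pos[OF e mult_pos_pos[OF c(1) c(1)]] by (auto simp: padic_Cauchy_iff)
  have "padic_abs_rat p (inverse (s m) - inverse (s n)) < e"
    if mn: "m \<ge> max N M" "n \<ge> max N M" for m n
  proof -
    have a: "padic_abs_rat p (s m) > c" "padic_abs_rat p (s n) > c" using c mn by auto
    have nz: "s m \<noteq> 0" "s n \<noteq> 0" using a c(1) by auto
    have "inverse (s m) - inverse (s n) = (s n - s m) * inverse (s m * s n)"
      using nz by (simp add: field_simps)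
    hence "padic_abs_rat p (inverse (s m) - inverse (s n)) =
        padic_abs_rat p (s n - s m) / (padic_abs_rat p (s m) * padic_abs_rat p (s n))"
      by (simp only: padic_abs_rat_mult[OF p] padic_abs_rat_inverse[OF p] divide_inverse)
    also have "\<dots> \<le> padic_abs_rat p (s n - s m) / (c * c)"
      by (rule divide_left_mono) (use a c(1) in \<open>auto intro!: mult_mono mult_pos_pos\<close>)
    also have "\<dots> < e" using M mn c(1) by (simp add: divide_less_eq)
    finally show ?thesis .
  qed
  thus "\<exists>N. \<forall>m\<ge>N. \<forall>n\<ge>N. padic_abs_rat p (inverse (s m) - inverse (s n)) < e" by blast
qed

lemma padic_null_maximalideal:
  assumes p: "prime p"
  shows "maximalideal (padic_null p) (padic_Cauchy_ring p)"
proof (rule maximalidealI)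
  let ?R = "padic_Cauchy_ring p"
  interpret cring ?R by (rule padic_Cauchy_ring_cring[OF p])
  show "ideal (padic_null p) ?R" by (rule padic_null_ideal[OF p])
  have "(\<lambda>_. 1) \<notin> padic_null p" by (simp add: padic_null_def LIMSEQ_const_iff)
  thus "carrier ?R \<noteq> padic_null p" using padic_Cauchy_const by blast
  fix J assume J: "ideal J ?R" "padic_null p \<subseteq> J" "J \<subseteq> carrier ?R"
  interpret J: ideal J ?R by fact
  show "J = padic_null p \<or> J = carrier ?R"
  proof (cases "J = padic_null p")
    case False
    then obtain s where s: "s \<in> J" "s \<notin> padic_null p" using J(2) by blast
    have sC: "s \<in> carrier ?R" using s J(3) by blast
    define t where "t = (\<lambda>n. inverse (s n))"
    have t: "t \<in> carrier ?R" unfolding t_def by (rule padic_Cauchy_inverse[OF p sC s(2)])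
    obtain c N where c: "c > 0" "\<And>n. n \<ge> N \<Longrightarrow> padic_abs_rat p (s n) > c"
      using padic_not_null_bounded_below[OF p sC s(2)] by blast
    have st: "(\<lambda>n. t n * s n) \<in> J" using J.I_l_closed[OF s(1) t] by simp
    have "\<forall>\<^sub>F n in sequentially. padic_abs_rat p (1 - t n * s n) = 0"
    proof (rule eventually_sequentiallyI)
      fix n assume "n \<ge> N"
      hence "s n \<noteq> 0" using c(2)[of n] c(1) by auto
      thus "padic_abs_rat p (1 - t n * s n) = 0" by (simp add: t_def)
    qed
    hence "(\<lambda>n. 1 - t n * s n) \<in> padic_null p"
      by (simp add: padic_null_def tendsto_eventually)
    hence "(\<lambda>n. 1 - t n * s n) \<in> J" using J(2) by blast
    from J.a_closed[OF this st] have "\<one>\<^bsub>?R\<^esub> \<in> J" by simp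
    thus ?thesis using J.one_imp_carrier by blast
  qed simp
qed

theorem padic_field_field: "prime p \<Longrightarrow> field (padic_field p)"
  unfolding padic_field_def
  by (intro maximalideal.quotient_is_field padic_null_maximalideal padic_Cauchy_ring_cring)

lemma padic_field_carrier:
  "carrier (padic_field p) =
     (\<lambda>s. padic_null p +>\<^bsub>padic_Cauchy_ring p\<^esub> s) ` carrier (padic_Cauchy_ring p)"
  by (auto simp: padic_field_def FactRing_def A_RCOSETS_def RCOSETS_def a_r_coset_def)

lemma padic_coset_hom:
  "prime p \<Longrightarrow> ring_hom_cring (padic_Cauchy_ring p) (padic_field p)
     (\<lambda>s. padic_null p +>\<^bsub>padic_Cauchy_ring p\<^esub> s)"
  unfolding padic_field_def
  by (intro ideal.rcos_ring_hom_cring padic_null_ideal padic_Cauchy_ring_cring)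

lemma padic_coset_diff:
  assumes p: "prime p" and s: "s \<in> carrier (padic_Cauchy_ring p)"
    and t: "t \<in> carrier (padic_Cauchy_ring p)"
  shows "(padic_null p +>\<^bsub>padic_Cauchy_ring p\<^esub> s) \<ominus>\<^bsub>padic_field p\<^esub>
           (padic_null p +>\<^bsub>padic_Cauchy_ring p\<^esub> t) =
         padic_null p +>\<^bsub>padic_Cauchy_ring p\<^esub> (\<lambda>n. s n - t n)"
proof -
  interpret h: ring_hom_cring "padic_Cauchy_ring p" "padic_field p"
      "(+>\<^bsub>padic_Cauchy_ring p\<^esub>) (padic_null p)"
    by (rule padic_coset_hom[OF p])
  show ?thesis
    using h.hom_add[OF s padic_Cauchy_uminus[OF p t]] h.hom_a_inv[OF t]
    by (simp add: a_minus_def p t)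
qed

lemma padic_abs_tendsto:
  assumes p: "prime p" and s: "s \<in> carrier (padic_Cauchy_ring p)"
  shows "(\<lambda>n. padic_abs_rat p (s n)) \<longlonglongrightarrow> padic_abs p (padic_null p +>\<^bsub>padic_Cauchy_ring p\<^esub> s)"
proof -
  let ?z = "padic_null p +>\<^bsub>padic_Cauchy_ring p\<^esub> s"
  define t where "t = (SOME t. t \<in> ?z)"
  have "(\<lambda>_. 0) \<in> padic_null p" by (simp add: padic_null_def)
  hence "s \<in> ?z" by (force simp: a_r_coset_def r_coset_def)
  hence "t \<in> ?z" unfolding t_def by (rule someI[of "\<lambda>t. t \<in> ?z"])
  then obtain h where h: "h \<in> padic_null p" "t = (\<lambda>n. h n + s n)"
    by (auto simp: a_r_coset_def r_coset_def)
  obtain L where L: "(\<lambda>n. padic_abs_rat p (s n)) \<longlonglongrightarrow> L"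
    using padic_Cauchy_convergent[OF p s] by (auto simp: convergent_def)
  have "(\<lambda>n. padic_abs_rat p (t n) - padic_abs_rat p (s n)) \<longlonglongrightarrow> 0"
  proof (rule Lim_null_comparison)
    show "(\<lambda>n. padic_abs_rat p (h n)) \<longlonglongrightarrow> 0" using h by (simp add: padic_null_def)
    show "\<forall>\<^sub>F n in sequentially. norm (padic_abs_rat p (t n) - padic_abs_rat p (s n))
        \<le> padic_abs_rat p (h n)"
      using padic_abs_rat_triangle3[OF p, of "t n" "s n" for n] by (simp add: h)
  qed
  from tendsto_add[OF this L] have "(\<lambda>n. padic_abs_rat p (t n)) \<longlonglongrightarrow> L" by simp
  hence "padic_abs p ?z = L" by (simp add: padic_abs_def t_def limI)
  thus ?thesis using L by simp
qed

lemma padic_abs_of_rat: "prime p \<Longrightarrow> padic_abs p (padic_of_rat p q) = padic_abs_rat p q"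
  using padic_abs_tendsto[OF _ padic_Cauchy_const, of p q]
  by (auto simp: padic_of_rat_def LIMSEQ_const_iff)

text \<open>A series of rationals whose terms tend to 0 has a p-adic sum.\<close>

lemma padic_sums_of_rat:
  assumes p: "prime p" and q: "(\<lambda>k. padic_abs_rat p (q k)) \<longlonglongrightarrow> 0"
  shows "(\<lambda>n. \<Sum>k<n. q k) \<in> carrier (padic_Cauchy_ring p)"
    and "padic_sums p (\<lambda>k. padic_of_rat p (q k))
           (padic_null p +>\<^bsub>padic_Cauchy_ring p\<^esub> (\<lambda>n. \<Sum>k<n. q k))"
proof -
  let ?R = "padic_Cauchy_ring p" and ?K = "padic_field p" and ?h = "(+>\<^bsub>padic_Cauchy_ring p\<^esub>) (padic_null p)"
  define S where "S = (\<lambda>n. \<Sum>k<n. q k)"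
  interpret h: ring_hom_cring ?R ?K ?h by (rule padic_coset_hom[OF p])
  have diff: "padic_abs_rat p (S m - S n) < e"
    if e: "e > 0" and N: "\<And>k. k \<ge> N \<Longrightarrow> padic_abs_rat p (q k) < e" and mn: "m \<ge> n" "n \<ge> N" for e N m n
    using mn(1)
  proof (induction m rule: dec_induct)
    case base thus ?case using e by simp
  next
    case (step m)
    have "padic_abs_rat p ((S m - S n) + q m) \<le> max (padic_abs_rat p (S m - S n)) (padic_abs_rat p (q m))"
      by (rule padic_abs_rat_add_le[OF p])
    also have "\<dots> < e" using step N[of m] mn(2) by simp
    finally show ?case by (simp add: S_def algebra_simps)
  qed
  have small: "\<exists>N. \<forall>k\<ge>N. padic_abs_rat p (q k) < e" if "e > 0" for e
    using order_tendstoD(2)[OF q that] by (simp add: eventually_sequentially)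
  show "(\<lambda>n. \<Sum>k<n. q k) \<in> carrier ?R"
    unfolding S_def[symmetric] padic_Cauchy_iff
  proof (intro allI impI)
    fix e :: real assume e: "e > 0"
    then obtain N where N: "\<And>k. k \<ge> N \<Longrightarrow> padic_abs_rat p (q k) < e" using small by blast
    have "padic_abs_rat p (S m - S n) < e" if "m \<ge> N" "n \<ge> N" for m n
      using diff[OF e N, of N n m] diff[OF e N, of N m n] that
        padic_abs_rat_minus_commute[OF p, of "S m" "S n"] by (cases "m \<ge> n") auto
    thus "\<exists>N. \<forall>m\<ge>N. \<forall>n\<ge>N. padic_abs_rat p (S m - S n) < e" by blast
  qed
  hence SC: "S \<in> carrier ?R" by (simp add: S_def)
  have fin: "(\<Oplus>\<^bsub>?K\<^esub>k\<in>{..<n}. padic_of_rat p (q k)) = ?h (\<lambda>_. S n)" for n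
  proof (induction n)
    case 0
    have "?h (\<lambda>_. 0) = \<zero>\<^bsub>?K\<^esub>" using h.hom_zero by simp
    thus ?case by (simp add: S_def)
  next
    case (Suc n)
    have c: "(\<lambda>_. r) \<in> carrier ?R" for r by (rule padic_Cauchy_const)
    have "(\<Oplus>\<^bsub>?K\<^esub>k\<in>{..<Suc n}. padic_of_rat p (q k)) =
        ?h (\<lambda>_. q n) \<oplus>\<^bsub>?K\<^esub> (\<Oplus>\<^bsub>?K\<^esub>k\<in>{..<n}. padic_of_rat p (q k))"
      unfolding lessThan_Suc padic_of_rat_def
      by (subst h.S.finsum_insert) (auto intro!: h.hom_closed c)
    also have "\<dots> = ?h (\<lambda>_. q n + S n)"
      unfolding Suc using h.hom_add[OF c[of "q n"] c[of "S n"]] by simp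
    finally show ?case by (simp add: S_def add.commute)
  qed
  have lim: "(\<lambda>n. padic_abs p (?h S \<ominus>\<^bsub>?K\<^esub> (\<Oplus>\<^bsub>?K\<^esub>k\<in>{..<n}. padic_of_rat p (q k)))) \<longlonglongrightarrow> 0"
  proof (rule LIMSEQ_I)
    fix e :: real assume e: "e > 0"
    then obtain N where N: "\<And>k. k \<ge> N \<Longrightarrow> padic_abs_rat p (q k) < e / 2" using small[of "e/2"] by auto
    have "norm (padic_abs p (?h S \<ominus>\<^bsub>?K\<^esub> (\<Oplus>\<^bsub>?K\<^esub>k\<in>{..<n}. padic_of_rat p (q k))) - 0) < e"
      if n: "n \<ge> N" for n
    proof -
      have eq: "?h S \<ominus>\<^bsub>?K\<^esub> ?h (\<lambda>_. S n) = ?h (\<lambda>m. S m - S n)"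
        by (rule padic_coset_diff[OF p SC padic_Cauchy_const])
      have C: "(\<lambda>m. S m - S n) \<in> carrier ?R"
        using padic_Cauchy_add[OF p SC padic_Cauchy_const[of "- S n"]] by simp
      have "padic_abs p (?h (\<lambda>m. S m - S n)) \<le> e / 2"
        by (rule LIMSEQ_le_const2[OF padic_abs_tendsto[OF p C]])
          (use diff[of "e/2" N, OF _ N] e n in \<open>force intro!: exI[of _ n] less_imp_le\<close>)
      moreover have "padic_abs p (?h (\<lambda>m. S m - S n)) \<ge> 0"
        by (rule LIMSEQ_le_const[OF padic_abs_tendsto[OF p C]]) auto
      ultimately show ?thesis using e by (simp add: fin eq)
    qed
    thus "\<exists>N. \<forall>n\<ge>N. norm (padic_abs p (?h S \<ominus>\<^bsub>?K\<^esub> (\<Oplus>\<^bsub>?K\<^esub>k\<in>{..<n}. padic_of_rat p (q k))) - 0) < e"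
      by blast
  qed
  show "padic_sums p (\<lambda>k. padic_of_rat p (q k)) (?h (\<lambda>n. \<Sum>k<n. q k))"
    using lim SC by (simp add: padic_sums_def padic_field_carrier S_def)
qed

lemma padic_abs_nonneg:
  assumes p: "prime p" and z: "z \<in> carrier (padic_field p)"
  shows "padic_abs p z \<ge> 0"
proof -
  obtain s where s: "s \<in> carrier (padic_Cauchy_ring p)"
    "z = padic_null p +>\<^bsub>padic_Cauchy_ring p\<^esub> s"
    using z by (auto simp: padic_field_carrier)
  show ?thesis unfolding s(2) by (rule LIMSEQ_le_const[OF padic_abs_tendsto[OF p s(1)]]) auto
qed

lemma padic_abs_eq_0_iff:
  assumes p: "prime p" and z: "z \<in> carrier (padic_field p)"
  shows "padic_abs p z = 0 \<longleftrightarrow> z = \<zero>\<^bsub>padic_field p\<^esub>"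
proof -
  obtain s where s: "s \<in> carrier (padic_Cauchy_ring p)"
    "z = padic_null p +>\<^bsub>padic_Cauchy_ring p\<^esub> s"
    using z by (auto simp: padic_field_carrier)
  interpret ideal "padic_null p" "padic_Cauchy_ring p" by (rule padic_null_ideal[OF p])
  have "padic_abs p z = 0 \<longleftrightarrow> s \<in> padic_null p"
    using padic_abs_tendsto[OF p s(1)] LIMSEQ_unique unfolding s(2)
    by (metis (mono_tags, lifting) padic_null_def mem_Collect_eq)
  also have "\<dots> \<longleftrightarrow> z = padic_null p"
    unfolding s(2) using rcos_const_imp_mem[OF s(1)] a_rcos_zero[OF ideal_axioms, of s] by blast
  finally show ?thesis by (simp add: padic_field_def FactRing_def)
qed

lemma padic_abs_mult:
  assumes p: "prime p" and z: "z \<in> carrier (padic_field p)" "w \<in> carrier (padic_field p)"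
  shows "padic_abs p (z \<otimes>\<^bsub>padic_field p\<^esub> w) = padic_abs p z * padic_abs p w"
proof -
  let ?R = "padic_Cauchy_ring p" and ?h = "(+>\<^bsub>padic_Cauchy_ring p\<^esub>) (padic_null p)"
  obtain s t where s: "s \<in> carrier ?R" "z = ?h s" and t: "t \<in> carrier ?R" "w = ?h t"
    using z by (auto simp: padic_field_carrier)
  interpret h: ring_hom_cring ?R "padic_field p" ?h by (rule padic_coset_hom[OF p])
  have "?h s \<otimes>\<^bsub>padic_field p\<^esub> ?h t = ?h (\<lambda>n. s n * t n)"
    using h.hom_mult[OF s(1) t(1)] by simp
  moreover have "(\<lambda>n. padic_abs_rat p (s n * t n)) \<longlonglongrightarrow> padic_abs p (?h s) * padic_abs p (?h t)"
    using tendsto_mult[OF padic_abs_tendsto[OF p s(1)] padic_abs_tendsto[OF p t(1)]]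
    by (simp add: padic_abs_rat_mult[OF p])
  ultimately show ?thesis
    using LIMSEQ_unique padic_abs_tendsto[OF p padic_Cauchy_mult[OF p s(1) t(1)]]
    unfolding s(2) t(2) by metis
qed

lemma padic_abs_diff_le:
  assumes p: "prime p" and z: "z \<in> carrier (padic_field p)" "w \<in> carrier (padic_field p)"
  shows "padic_abs p (z \<ominus>\<^bsub>padic_field p\<^esub> w) \<le> max (padic_abs p z) (padic_abs p w)"
proof -
  let ?R = "padic_Cauchy_ring p" and ?h = "(+>\<^bsub>padic_Cauchy_ring p\<^esub>) (padic_null p)"
  obtain s t where s: "s \<in> carrier ?R" "z = ?h s" and t: "t \<in> carrier ?R" "w = ?h t"
    using z by (auto simp: padic_field_carrier)
  have eq: "?h s \<ominus>\<^bsub>padic_field p\<^esub> ?h t = ?h (\<lambda>n. s n - t n)"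
    by (rule padic_coset_diff[OF p s(1) t(1)])
  have C: "(\<lambda>n. s n - t n) \<in> carrier ?R"
    using padic_Cauchy_add[OF p s(1) padic_Cauchy_uminus[OF p t(1)]] by simp
  have "padic_abs_rat p (s n - t n) \<le> max (padic_abs_rat p (s n)) (padic_abs_rat p (t n))" for n
    using padic_abs_rat_add_le[OF p, of "s n" "- t n"] by (simp add: padic_abs_rat_minus[OF p])
  thus ?thesis unfolding s(2) t(2) eq
    by (intro LIMSEQ_le[OF padic_abs_tendsto[OF p C]
          tendsto_max[OF padic_abs_tendsto[OF p s(1)] padic_abs_tendsto[OF p t(1)]]]) auto
qed

lemma padic_suminf_eqI:
  assumes p: "prime p" and f: "\<And>k. f k \<in> carrier (padic_field p)" and z: "padic_sums p f z"
  shows "padic_suminf p f = z"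
  unfolding padic_suminf_def
proof (rule the_equality)
  fix w assume w: "padic_sums p f w"
  let ?K = "padic_field p"
  interpret field ?K by (rule padic_field_field[OF p])
  define S where "S = (\<lambda>n. \<Oplus>\<^bsub>?K\<^esub>k\<in>{..<n}. f k)"
  have S: "S n \<in> carrier ?K" for n unfolding S_def using f by (intro finsum_closed) auto
  have zw: "z \<in> carrier ?K" "w \<in> carrier ?K" using z w by (auto simp: padic_sums_def)
  have lim: "(\<lambda>n. max (padic_abs p (w \<ominus>\<^bsub>?K\<^esub> S n)) (padic_abs p (z \<ominus>\<^bsub>?K\<^esub> S n))) \<longlonglongrightarrow> 0"
    using tendsto_max[of "\<lambda>n. padic_abs p (w \<ominus>\<^bsub>?K\<^esub> S n)" 0 sequentially
        "\<lambda>n. padic_abs p (z \<ominus>\<^bsub>?K\<^esub> S n)" 0] z w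
    by (simp add: padic_sums_def S_def)
  have "padic_abs p (w \<ominus>\<^bsub>?K\<^esub> z) \<le> max (padic_abs p (w \<ominus>\<^bsub>?K\<^esub> S n)) (padic_abs p (z \<ominus>\<^bsub>?K\<^esub> S n))" for n
  proof -
    have "w \<ominus>\<^bsub>?K\<^esub> z = (w \<ominus>\<^bsub>?K\<^esub> S n) \<ominus>\<^bsub>?K\<^esub> (z \<ominus>\<^bsub>?K\<^esub> S n)"
      using zw S[of n] by algebra
    thus ?thesis using padic_abs_diff_le[OF p, of "w \<ominus>\<^bsub>?K\<^esub> S n" "z \<ominus>\<^bsub>?K\<^esub> S n"] zw S[of n] by simp
  qed
  hence "padic_abs p (w \<ominus>\<^bsub>?K\<^esub> z) \<le> 0" by (intro LIMSEQ_le_const[OF lim]) auto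
  hence "w \<ominus>\<^bsub>?K\<^esub> z = \<zero>\<^bsub>?K\<^esub>"
    using padic_abs_nonneg[OF p, of "w \<ominus>\<^bsub>?K\<^esub> z"] padic_abs_eq_0_iff[OF p, of "w \<ominus>\<^bsub>?K\<^esub> z"] zw by simp
  moreover have "w = (w \<ominus>\<^bsub>?K\<^esub> z) \<oplus>\<^bsub>?K\<^esub> z" using zw by algebra
  ultimately show "w = z" using zw by simp
qed (fact z)

end

theory Submission
  imports Defs "HOL-Real_Asymp.Real_Asymp"
begin

text \<open>
  Write \<open>S\<^sub>k\<close> for the sum of the first \<open>k\<close> terms, so that \<open>\<xi> - S\<^sub>k\<close> has valuation \<open>a\<^sub>k\<close>. The pairs
  \<open>(S\<^sub>k, 1)\<close> and their multiples by powers of \<open>p\<close> give all lower bounds, and comparing an arbitrary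
  pair with a single \<open>S\<^sub>k\<close> suffices for the upper bound of the uniform exponent.

  The upper bound \<open>\<mu>(\<xi>) \<le> d\<close> is delicate for \<open>d < 3\<close>, where such a comparison is too weak. Instead one bounds
  the shortest vectors of the lattices \<open>\<Lambda>(M)\<close> of all \<open>(x, y)\<close> with \<open>x \<equiv> y \<xi>\<close> modulo \<open>p\<^sup>M\<close>. With \<open>n = a\<^sub>k\<close>,
  a bilinear pairing between \<open>\<Lambda>(2n - M)\<close> and \<open>\<Lambda>(M)\<close> takes values divisible by \<open>p\<^sup>n\<close>; it is the
  counterpart of the folding symmetry of the continued fractions of real lacunary series. Because
  \<open>a\<^sub>k \<ge> 2 a\<^sub>k\<^sub>-\<^sub>1\<close>, its size is at most a constant times the product of the heights, so a short
  vector of \<open>\<Lambda>(2n - M)\<close> is excluded by a reduced basis of \<open>\<Lambda>(M)\<close>, and induction on \<open>k\<close> applies.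
  Finally \<open>max |x| |y| \<le> |x y|\<close> yields \<open>\<mu>\<^sup>\<times>(\<xi>) \<le> 2 \<mu>(\<xi>)\<close>.
\<close>

section \<open>Lattices of congruences\<close>

text \<open>Stop Euclid's algorithm for \<open>q\<close> and \<open>A\<close> where the remainder drops below its cofactor.\<close>

lemma reduced_basis:
  fixes q A :: int
  assumes q: "q > 0"
  obtains X1 Y1 X2 Y2 :: int where
    "q dvd X1 - Y1 * A" "q dvd X2 - Y2 * A" "X1 * Y2 \<noteq> X2 * Y1"
    "max \<bar>X1\<bar> \<bar>Y1\<bar> * max \<bar>X2\<bar> \<bar>Y2\<bar> \<le> q"
proof -
  \<comment> \<open>\<open>(r, t)\<close> and \<open>(r', t')\<close> are consecutive remainders
    with their cofactors of \<open>A\<close>. The cofactors alternate in sign, so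
    \<open>r * |t'| + r' * |t| = q\<close> says that the determinant has absolute value
    \<open>q\<close> throughout.\<close>
  have euclid: "\<exists>X1 Y1 X2 Y2. q dvd X1 - Y1 * A \<and> q dvd X2 - Y2 * A \<and> X1 * Y2 \<noteq> X2 * Y1 \<and>
      max \<bar>X1\<bar> \<bar>Y1\<bar> * max \<bar>X2\<bar> \<bar>Y2\<bar> \<le> q"
    if "0 \<le> r'" "r' < r" "\<bar>t\<bar> \<le> r" "t * t' \<le> 0" "r * \<bar>t'\<bar> + r' * \<bar>t\<bar> = q"
      "q dvd r - t * A" "q dvd r' - t' * A" for r r' t t' :: int
    using that
  proof (induction "nat r'" arbitrary: r r' t t' rule: less_induct)
    case less
    show ?case
    proof (cases "r' \<le> \<bar>t'\<bar>")
      case True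
      \<comment> \<open>Equal products of weakly opposite sign both vanish, against the invariant
        with value \<open>q > 0\<close>.\<close>
      have "r * t' \<noteq> r' * t"
      proof
        assume eq: "r * t' = r' * t"
        have "(r * t') * (r' * t) = (r * r') * (t * t')" by (simp add: algebra_simps)
        also have "\<dots> \<le> 0" using less.prems(1,2) by (intro mult_nonneg_nonpos[OF _ less.prems(4)]) simp
        finally have "(r * t') * (r * t') \<le> 0" using eq by simp
        hence "r * t' = 0" by (metis zero_le_square order_antisym mult_eq_0_iff)
        hence "r * \<bar>t'\<bar> + r' * \<bar>t\<bar> = 0" using eq less.prems by (auto simp: abs_mult)
        thus False using less.prems q by simp
      qed
      \<comment> \<open>By \<open>|t| <= r\<close> and \<open>r' <= |t'|\<close> the two heights are
        \<open>r\<close> and \<open>|t'|\<close>, whose product is one summand of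
        \<open>q\<close>.\<close>
      moreover have "max \<bar>r\<bar> \<bar>t\<bar> * max \<bar>r'\<bar> \<bar>t'\<bar> \<le> q"
      proof -
        have "0 \<le> r' * \<bar>t\<bar>" using less.prems by simp
        moreover have "max \<bar>r\<bar> \<bar>t\<bar> = r" "max \<bar>r'\<bar> \<bar>t'\<bar> = \<bar>t'\<bar>" using True less.prems by auto
        ultimately show ?thesis using less.prems(5) by simp
      qed
      ultimately show ?thesis using less.prems by blast
    next
      case False
      hence r': "r' > 0" "\<bar>t'\<bar> \<le> r'" using less.prems by auto
      define s where "s = r div r'"
      define r2 where "r2 = r - s * r'"
      define t2 where "t2 = t - s * t'"
      have s: "s \<ge> 0" using less.prems r' by (simp add: s_def pos_imp_zdiv_nonneg_iff)
      have r2: "r2 = r mod r'" by (simp add: r2_def s_def minus_div_mult_eq_mod)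
      have r2b: "0 \<le> r2" "r2 < r'" using r' by (simp_all add: r2)
      \<comment> \<open>Opposite signs of \<open>t\<close> and \<open>t'\<close> rule out
        cancellation, so the determinant invariant is preserved exactly.\<close>
      have abs2: "\<bar>t2\<bar> = \<bar>t\<bar> + s * \<bar>t'\<bar>"
      proof (cases "t' \<ge> 0")
        case True
        hence "t \<le> 0 \<or> t' = 0" using less.prems(4) by (auto simp: mult_le_0_iff)
        moreover have "s * t' \<ge> 0" using True s by simp
        ultimately show ?thesis using True by (auto simp: t2_def)
      next
        case False
        hence "t \<ge> 0" using less.prems(4) by (auto simp: mult_le_0_iff)
        moreover have "s * t' \<le> 0" using False s by (simp add: mult_le_0_iff)
        ultimately show ?thesis using False by (auto simp: t2_def)
      qed
      have "t' * t2 \<le> 0"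
      proof -
        have "t' * t2 = t * t' - s * (t' * t')" by (simp add: t2_def algebra_simps)
        moreover have "0 \<le> s * (t' * t')" using s by simp
        ultimately show ?thesis using less.prems(4) by linarith
      qed
      moreover have "r' * \<bar>t2\<bar> + r2 * \<bar>t'\<bar> = q"
        using less.prems(5) by (simp add: abs2 r2_def algebra_simps)
      moreover have "q dvd r2 - t2 * A"
      proof -
        have "r2 - t2 * A = (r - t * A) - s * (r' - t' * A)"
          by (simp add: r2_def t2_def algebra_simps)
        thus ?thesis using less.prems by simp
      qed
      moreover have "nat r2 < nat r'" using r2b by simp
      ultimately show ?thesis
        using less.hyps[of r2 r' t' t2] r2b r' less.prems by blast
    qed
  qed
  \<comment> \<open>The algorithm starts from the vectors \<open>(q, 0)\<close> and
    \<open>(A mod q, 1)\<close>.\<close>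
  have "q dvd A mod q - 1 * A" by (metis dvd_minus_mod dvd_minus_iff minus_diff_eq mult_1)
  hence "\<exists>X1 Y1 X2 Y2. q dvd X1 - Y1 * A \<and> q dvd X2 - Y2 * A \<and> X1 * Y2 \<noteq> X2 * Y1 \<and>
      max \<bar>X1\<bar> \<bar>Y1\<bar> * max \<bar>X2\<bar> \<bar>Y2\<bar> \<le> q"
    using q by (intro euclid[of "A mod q" q 0 1]) auto
  thus ?thesis using that by blast
qed

section \<open>The folding pairing\<close>

text \<open>Dividing the congruence for \<open>(x, y)\<close> by \<open>Q\<close> shows that
  \<open>q'\<close> divides \<open>e - y\<close>. Modulo \<open>Q\<close> the pairing is
  \<open>(e - y) * (X - Y * A)\<close>, a multiple of \<open>q'\<close> times a multiple of
  \<open>q\<close>.\<close>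

lemma folding_dvd:
  fixes Q q q' A x y X Y e :: int
  assumes Q: "Q = q * q'" "Q \<noteq> 0" and e: "x - y * A = Q * e"
    and u: "Q * q' dvd x - y * (A + Q)" and v: "q dvd X - Y * A"
  shows "Q dvd e * (X - Y * A) + (x * Y - y * X)"
proof -
  obtain f where f: "x - y * (A + Q) = Q * q' * f" using u by auto
  obtain F where F: "X - Y * A = q * F" using v by auto
  have "Q * e = Q * (y + q' * f)" using e f by (simp add: algebra_simps)
  hence e': "e = y + q' * f" using Q by simp
  have X: "X = Y * A + q * F" and x: "x = y * A + Q * e" using F e by (simp_all add: algebra_simps)
  have "e * (X - Y * A) + (x * Y - y * X) = (e - y) * q * F + Q * e * Y"
    unfolding X x by (simp add: algebra_simps)
  also have "\<dots> = Q * (f * F + e * Y)" by (simp add: e' Q algebra_simps)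
  finally show ?thesis by simp
qed

text \<open>A nonzero \<open>(x, y)\<close> cannot pair to zero with two independent vectors, and a
  nonzero value is at least \<open>Q\<close> in size. The hypothesis on \<open>(1 + A)\<close>
  bounds the term with \<open>e\<close> by \<open>4 * h * H\<close>; the two remaining products add
  \<open>h * H\<close> each, whence the constant 6.\<close>

lemma folding_bound:
  fixes Q q q' A x y X1 Y1 X2 Y2 :: int
  assumes Q: "Q = q * q'" "Q > 0" and A: "A \<ge> 0" "(1 + A)\<^sup>2 \<le> 4 * Q"
    and u: "Q * q' dvd x - y * (A + Q)" "x \<noteq> 0 \<or> y \<noteq> 0"
    and v: "q dvd X1 - Y1 * A" "q dvd X2 - Y2 * A" "X1 * Y2 \<noteq> X2 * Y1"
    and H: "max \<bar>X1\<bar> \<bar>Y1\<bar> \<le> H" "max \<bar>X2\<bar> \<bar>Y2\<bar> \<le> H"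
  shows "Q \<le> 6 * max \<bar>x\<bar> \<bar>y\<bar> * H"
proof -
  have "Q dvd x - y * (A + Q)" using u(1) dvd_mult_left by blast
  moreover have "x - y * A = x - y * (A + Q) + Q * y" by (simp add: algebra_simps)
  ultimately have "Q dvd x - y * A" by (metis dvd_add dvd_triv_left)
  then obtain e where e: "x - y * A = Q * e" by blast
  define G where "G = (\<lambda>X Y. e * (X - Y * A) + (x * Y - y * X))"
  define h where "h = max \<bar>x\<bar> \<bar>y\<bar>"
  have h: "\<bar>x\<bar> \<le> h" "\<bar>y\<bar> \<le> h" "h \<ge> 0" by (auto simp: h_def)
  have bound: "Q \<le> 6 * h * H"
    if G: "G X Y \<noteq> 0" and XY: "q dvd X - Y * A" "max \<bar>X\<bar> \<bar>Y\<bar> \<le> H" for X Y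
  proof -
    have XY': "\<bar>X\<bar> \<le> H" "\<bar>Y\<bar> \<le> H" "H \<ge> 0" using XY(2) by auto
    have "Q dvd G X Y" unfolding G_def using folding_dvd[OF Q(1) _ e u(1) XY(1)] Q(2) by blast
    hence GQ: "Q \<le> \<bar>G X Y\<bar>" using G zdvd_imp_le[of Q "\<bar>G X Y\<bar>"] by simp
    have "Q * \<bar>e\<bar> = \<bar>x - y * A\<bar>" unfolding e using abs_of_pos[OF Q(2)] by (simp only: abs_mult)
    also have "\<dots> \<le> \<bar>x\<bar> + \<bar>y\<bar> * A" using A abs_triangle_ineq4[of x "y * A"] by (simp add: abs_mult)
    also have "\<dots> \<le> h + h * A" by (intro add_mono mult_right_mono) (use h A in auto)
    finally have eb: "Q * \<bar>e\<bar> \<le> h * (1 + A)" by (simp add: algebra_simps)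
    \<comment> \<open>The second factor \<open>1 + A\<close> comes from
      \<open>|X - Y * A| <= H * (1 + A)\<close>; the resulting square is what \<open>A(2)\<close>
      compares with \<open>Q\<close>.\<close>
    have "Q * (\<bar>e\<bar> * (1 + A)) \<le> h * (1 + A) * (1 + A)"
      using mult_right_mono[OF eb, of "1 + A"] A by (simp add: mult.assoc)
    also have "\<dots> = h * (1 + A)\<^sup>2" by (simp add: power2_eq_square)
    also have "\<dots> \<le> h * (4 * Q)" by (rule mult_left_mono) (use A h in auto)
    finally have "Q * (\<bar>e\<bar> * (1 + A)) \<le> Q * (4 * h)" by (simp add: algebra_simps)
    hence eA: "\<bar>e\<bar> * (1 + A) \<le> 4 * h" using Q(2) mult_le_cancel_left_pos by blast
    have "\<bar>X - Y * A\<bar> \<le> \<bar>X\<bar> + \<bar>Y\<bar> * A" using A abs_triangle_ineq4[of X "Y * A"] by (simp add: abs_mult)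
    also have "\<dots> \<le> H + H * A" by (intro add_mono mult_right_mono) (use XY' A in auto)
    finally have "\<bar>e\<bar> * \<bar>X - Y * A\<bar> \<le> \<bar>e\<bar> * (H + H * A)" by (intro mult_left_mono) auto
    also have "\<dots> = \<bar>e\<bar> * (1 + A) * H" by (simp add: algebra_simps)
    also have "\<dots> \<le> 4 * h * H" by (rule mult_right_mono[OF eA]) (use XY' in auto)
    finally have 1: "\<bar>e * (X - Y * A)\<bar> \<le> 4 * h * H" by (simp add: abs_mult)
    have 2: "\<bar>x * Y\<bar> \<le> h * H" unfolding abs_mult by (rule mult_mono) (use h XY' in auto)
    have 3: "\<bar>y * X\<bar> \<le> h * H" unfolding abs_mult by (rule mult_mono) (use h XY' in auto)
    show ?thesis using GQ 1 2 3 unfolding G_def by linarith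
  qed
  have "G X1 Y1 \<noteq> 0 \<or> G X2 Y2 \<noteq> 0"
  proof (rule ccontr)
    assume "\<not> ?thesis"
    \<comment> \<open>As a linear form in \<open>(X, Y)\<close> the pairing has coefficients
      \<open>e - y\<close> and \<open>x - e * A\<close>. Vanishing at two independent vectors makes
      both zero, so \<open>Q * e = x - y * A = 0\<close> and then \<open>x = y = 0\<close>.\<close>
    hence z: "X1 * (e - y) + Y1 * (x - e * A) = 0" "X2 * (e - y) + Y2 * (x - e * A) = 0"
      by (auto simp: G_def algebra_simps)
    have "(X1 * Y2 - X2 * Y1) * (e - y) =
        Y2 * (X1 * (e - y) + Y1 * (x - e * A)) - Y1 * (X2 * (e - y) + Y2 * (x - e * A))"
      by (simp add: algebra_simps)
    hence "e = y" using z v(3) by simp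
    have "(X1 * Y2 - X2 * Y1) * (x - e * A) =
        X1 * (X2 * (e - y) + Y2 * (x - e * A)) - X2 * (X1 * (e - y) + Y1 * (x - e * A))"
      by (simp add: algebra_simps)
    hence "x = e * A" using z v(3) by simp
    with \<open>e = y\<close> e Q(2) have "y = 0" by simp
    with \<open>e = y\<close> \<open>x = e * A\<close> u(2) show False by simp
  qed
  thus ?thesis using bound v H by (auto simp: h_def)
qed

section \<open>Partial sums and heights of lattice vectors\<close>

locale lacunary_padic =
  fixes p :: nat and a :: "nat \<Rightarrow> nat"
  assumes p: "prime p" and a_mono: "strict_mono a" and a_0: "a 0 = 0"
begin

definition psum :: "nat \<Rightarrow> int" where
  "psum k = (\<Sum>j<k. int p ^ a j)"

lemma psum_Suc: "psum (Suc k) = psum k + int p ^ a k"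
  by (simp add: psum_def)

lemma p_ge_2: "p \<ge> 2"
  using p by (rule prime_ge_2_nat)

lemma psum_nonneg: "psum k \<ge> 0"
  by (simp add: psum_def sum_nonneg)

text \<open>The last term dominates because the exponents increase and \<open>p >= 2\<close>. The
  \<open>+ 1\<close> serves size estimates such as
  \<open>|x - y * psum (Suc k)| <= h * (psum (Suc k) + 1)\<close>.\<close>

lemma psum_Suc_bound: "psum (Suc k) + 1 \<le> 2 * int p ^ a k"
proof (induction k)
  case 0
  show ?case by (simp add: psum_def a_0)
next
  case (Suc k)
  have "a k + 1 \<le> a (Suc k)" using strict_monoD[OF a_mono, of k "Suc k"] by simp
  hence "int p ^ (a k + 1) \<le> int p ^ a (Suc k)"
    using p_ge_2 by (intro power_increasing) auto
  moreover have "2 * int p ^ a k \<le> int p ^ (a k + 1)"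
    using p_ge_2 by (simp add: mult_right_mono)
  ultimately show ?case using Suc by (simp add: psum_Suc)
qed

lemma psum_Suc_ge: "int p ^ a k \<le> psum (Suc k)"
  using psum_nonneg[of k] by (simp add: psum_Suc)

lemma psum_dvd: "k \<le> n \<Longrightarrow> int p ^ a k dvd psum n - psum k"
proof (induction n rule: dec_induct)
  case (step n)
  have "int p ^ a k dvd int p ^ a n"
    using step strict_mono_leD[OF a_mono] by (intro le_imp_power_dvd) auto
  moreover have "psum (Suc n) - psum k = (psum n - psum k) + int p ^ a n" by (simp add: psum_Suc)
  ultimately show ?case using step.IH by (metis dvd_add)
qed simp

text \<open>Induction on \<open>k\<close>: for \<open>a k < M \<le> 2 * a k\<close> the folding pairing reflects \<open>M\<close> to \<open>2 * a k - M\<close>, and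
  each reflection costs the factor \<open>6\<close>. Larger \<open>M\<close> are handled by comparison with \<open>psum (Suc k)\<close>.\<close>

lemma height_lower_bound:
  fixes D :: real and k0 k :: nat and x y :: int
  assumes D: "D \<ge> 2" and growth: "\<And>i. i \<ge> k0 \<Longrightarrow> 2 * a i \<le> a (Suc i)"
    "\<And>i. i \<ge> k0 \<Longrightarrow> real (a (Suc i)) \<le> D * real (a i)"
    and k: "k \<ge> Suc k0" and M: "M \<le> a k" and nz: "x \<noteq> 0 \<or> y \<noteq> 0"
    and dvd: "int p ^ M dvd x - y * psum k"
  shows "real p powr (real M / D)
    \<le> real p ^ a (Suc k0) * 6 ^ k * real_of_int (max \<bar>x\<bar> \<bar>y\<bar>)"
  using k M nz dvd
proof (induction k arbitrary: M x y rule: dec_induct)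
  case base
  have p1: "real p \<ge> 1" using p_ge_2 by simp
  \<comment> \<open>At the starting index the constant \<open>p ^ a (Suc k0)\<close> absorbs
    everything, since a nonzero integer vector has height at least 1.\<close>
  have "real M / D \<le> real (a (Suc k0))"
    using base(1) D by (simp add: divide_le_eq) (smt (verit) mult_left_le of_nat_0_le_iff of_nat_le_iff mult_right_mono mult_le_cancel_left1)
  hence "real p powr (real M / D) \<le> real p powr real (a (Suc k0))"
    using p1 by (intro powr_mono) auto
  also have "\<dots> = real p ^ a (Suc k0) * 1" using p_ge_2 by (simp add: powr_realpow)
  also have "\<dots> \<le> real p ^ a (Suc k0) * (6 ^ Suc k0 * real_of_int (max \<bar>x\<bar> \<bar>y\<bar>))"
  proof (rule mult_left_mono)
    have "1 \<le> max \<bar>x\<bar> \<bar>y\<bar>" using base(2) by linarith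
    hence "1 * 1 \<le> 6 ^ Suc k0 * real_of_int (max \<bar>x\<bar> \<bar>y\<bar>)"
      by (intro mult_mono one_le_power) auto
    thus "1 \<le> 6 ^ Suc k0 * real_of_int (max \<bar>x\<bar> \<bar>y\<bar>)" by simp
  qed simp
  finally show ?case by (simp add: mult.assoc)
next
  case (step k)
  define K where "K = real p ^ a (Suc k0) * 6 ^ k"
  define h where "h = max \<bar>x\<bar> \<bar>y\<bar>"
  have p1: "real p \<ge> 1" "real p > 0" using p_ge_2 by auto
  have K: "K \<ge> 1" unfolding K_def using p1 mult_mono[of 1 "real p ^ a (Suc k0)" 1 "6 ^ k"] by simp
  have h: "\<bar>x\<bar> \<le> h" "\<bar>y\<bar> \<le> h" "h \<ge> 1" using step.prems(2) by (auto simp: h_def)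
  have main: "real p powr (real M / D) \<le> 6 * K * real_of_int h"
  proof -
    consider (low) "M \<le> a k" | (mid) "a k < M" "M \<le> 2 * a k" | (high) "2 * a k < M" by linarith
    thus ?thesis
    proof cases
      case low
      \<comment> \<open>\<open>psum (Suc k)\<close> and \<open>psum k\<close> differ by
        \<open>p ^ a k\<close>, which is zero modulo \<open>p ^ M\<close>.\<close>
      have "int p ^ M dvd y * int p ^ a k" using low by (intro dvd_mult le_imp_power_dvd)
      moreover have "x - y * psum k = (x - y * psum (Suc k)) + y * int p ^ a k"
        by (simp add: psum_Suc algebra_simps)
      ultimately have "int p ^ M dvd x - y * psum k" using step.prems(3) by (metis dvd_add)
      hence "real p powr (real M / D) \<le> K * real_of_int h"
        using step.IH[of M x y] low step.prems(2) by (simp add: K_def h_def)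
      also have "\<dots> \<le> 6 * K * real_of_int h" using K h by simp
      finally show ?thesis .
    next
      case mid
      \<comment> \<open>With \<open>q = p ^ M'\<close> and \<open>q' = p ^ (a k - M')\<close>,
        \<open>Q = p ^ a k\<close> satisfies \<open>Q = q * q'\<close> and
        \<open>Q * q' = p ^ M\<close>, as the folding pairing requires.\<close>
      define M' where "M' = 2 * a k - M"
      have M': "M' < a k" "M + M' = 2 * a k" using mid by (auto simp: M'_def)
      obtain X1 Y1 X2 Y2 where v: "int p ^ M' dvd X1 - Y1 * psum k" "int p ^ M' dvd X2 - Y2 * psum k"
        "X1 * Y2 \<noteq> X2 * Y1" "max \<bar>X1\<bar> \<bar>Y1\<bar> * max \<bar>X2\<bar> \<bar>Y2\<bar> \<le> int p ^ M'"
        using reduced_basis[of "int p ^ M'" "psum k"] p_ge_2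
        by (metis of_nat_0_less_iff pos2 order_less_le_trans zero_less_power)
      define H where "H = max (max \<bar>X1\<bar> \<bar>Y1\<bar>) (max \<bar>X2\<bar> \<bar>Y2\<bar>)"
      have IH1: "real p powr (real M' / D) \<le> K * real_of_int (max \<bar>X1\<bar> \<bar>Y1\<bar>)"
        using step.IH[of M' X1 Y1] M' v unfolding K_def by fastforce
      have IH2: "real p powr (real M' / D) \<le> K * real_of_int (max \<bar>X2\<bar> \<bar>Y2\<bar>)"
        using step.IH[of M' X2 Y2] M' v unfolding K_def by fastforce
      have prod: "real_of_int (max \<bar>X1\<bar> \<bar>Y1\<bar>) * real_of_int (max \<bar>X2\<bar> \<bar>Y2\<bar>) \<le> real p ^ M'"
      proof -
        have "real_of_int (max \<bar>X1\<bar> \<bar>Y1\<bar> * max \<bar>X2\<bar> \<bar>Y2\<bar>) \<le> real_of_int (int p ^ M')"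
          using v(4) by (simp only: of_int_le_iff)
        thus ?thesis by (simp only: of_int_mult of_int_power of_int_of_nat_eq)
      qed
      \<comment> \<open>By induction the smaller of the two heights is at least
        \<open>p powr (M' / D) / K\<close>; their product is at most \<open>p ^ M'\<close>, which
        bounds the larger height \<open>H\<close>.\<close>
      have HK: "real p powr (real M' / D) * real_of_int H \<le> K * real p ^ M'"
      proof (cases "max \<bar>X1\<bar> \<bar>Y1\<bar> \<le> max \<bar>X2\<bar> \<bar>Y2\<bar>")
        case True
        hence "real p powr (real M' / D) * real_of_int H
            \<le> K * real_of_int (max \<bar>X1\<bar> \<bar>Y1\<bar>) * real_of_int (max \<bar>X2\<bar> \<bar>Y2\<bar>)"
          unfolding H_def max_absorb2[OF True] by (intro mult_right_mono[OF IH1]) auto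
        also have "\<dots> \<le> K * real p ^ M'" unfolding mult.assoc
          by (rule mult_left_mono[OF prod]) (use K in auto)
        finally show ?thesis .
      next
        case False
        hence le: "max \<bar>X2\<bar> \<bar>Y2\<bar> \<le> max \<bar>X1\<bar> \<bar>Y1\<bar>" by linarith
        hence "real p powr (real M' / D) * real_of_int H
            \<le> K * real_of_int (max \<bar>X2\<bar> \<bar>Y2\<bar>) * real_of_int (max \<bar>X1\<bar> \<bar>Y1\<bar>)"
          unfolding H_def max_absorb1[OF le] by (intro mult_right_mono[OF IH2]) auto
        also have "\<dots> = K * (real_of_int (max \<bar>X1\<bar> \<bar>Y1\<bar>) * real_of_int (max \<bar>X2\<bar> \<bar>Y2\<bar>))" 
          by (simp only: mult_ac)
        also have "\<dots> \<le> K * real p ^ M'" by (rule mult_left_mono[OF prod]) (use K in auto)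
        finally show ?thesis .
      qed
      \<comment> \<open>Starting the induction at \<open>Suc k0\<close> makes the doubling
        hypothesis available at the predecessor \<open>k'\<close>. It keeps \<open>psum k\<close> of
        the order of the square root of \<open>p ^ a k\<close>.\<close>
      obtain k' where k': "k = Suc k'" "k' \<ge> k0" using step.hyps by (cases k) auto
      have sq: "(1 + psum k)\<^sup>2 \<le> 4 * int p ^ a k"
      proof -
        have "(1 + psum k)\<^sup>2 \<le> (2 * int p ^ a k')\<^sup>2"
          using psum_Suc_bound[of k'] psum_nonneg[of k] unfolding k'(1)
          by (intro power_mono) auto
        also have "\<dots> = 4 * int p ^ (2 * a k')" by (simp add: power_mult_distrib power_mult[symmetric] mult.commute)
        also have "\<dots> \<le> 4 * int p ^ a k"
          using growth(1)[OF k'(2)] p_ge_2 k'(1) by (intro mult_left_mono power_increasing) auto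
        finally show ?thesis .
      qed
      have Q: "int p ^ a k = int p ^ M' * int p ^ (a k - M')" using M' by (simp flip: power_add)
      have "a k + (a k - M') = M" using M' by linarith
      hence "int p ^ a k * int p ^ (a k - M') = int p ^ M" by (metis power_add)
      hence "int p ^ a k * int p ^ (a k - M') dvd x - y * (psum k + int p ^ a k)"
        using step.prems(3) by (simp add: psum_Suc)
      from folding_bound[OF Q _ psum_nonneg sq this step.prems(2) v(1-3), of H]
      have "int p ^ a k \<le> 6 * h * H" using p_ge_2 by (simp add: h_def H_def)
      hence "real_of_int (int p ^ a k) \<le> real_of_int (6 * h * H)" by (simp only: of_int_le_iff)
      hence Qle: "real p ^ a k \<le> 6 * real_of_int h * real_of_int H" by simp
      have "real p ^ a k * real p powr (real M' / D)
          \<le> 6 * real_of_int h * real_of_int H * real p powr (real M' / D)"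
        by (rule mult_right_mono[OF Qle]) simp
      also have "\<dots> = 6 * real_of_int h * (real p powr (real M' / D) * real_of_int H)" by simp
      also have "\<dots> \<le> 6 * real_of_int h * (K * real p ^ M')"
        by (rule mult_left_mono[OF HK]) (use h in auto)
      finally have "real p powr (real (a k) + real M' / D) \<le> (6 * K * real_of_int h) * real p powr real M'"
        using p1 by (simp add: powr_add powr_realpow algebra_simps)
      hence le: "real p powr (real (a k) + real M' / D - real M') \<le> 6 * K * real_of_int h"
        using p1 by (simp add: powr_diff divide_le_eq)
      have "real M / D \<le> real (a k) + real M' / D - real M'"
      proof -
        have MM: "real M = 2 * real (a k) - real M'" using M' by linarith
        \<comment> \<open>\<open>D >= 2\<close> makes this difference nonnegative, so reflecting
          \<open>M\<close> costs nothing in the exponent.\<close>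
        have "real (a k) + real M' / D - real M' - real M / D = (real (a k) - real M') * (D - 2) / D"
          using D by (simp add: MM field_simps)
        moreover have "0 \<le> (real (a k) - real M') * (D - 2) / D" using M' D by simp
        ultimately show ?thesis by linarith
      qed
      hence "real p powr (real M / D) \<le> real p powr (real (a k) + real M' / D - real M')"
        using p1 by (intro powr_mono) auto
      thus ?thesis using le by linarith
    next
      case high
      show ?thesis
      proof (cases "x = y * psum (Suc k)")
        case True
        hence y: "y \<noteq> 0" using step.prems(2) by auto
        \<comment> \<open>A nonzero multiple of \<open>(psum (Suc k), 1)\<close> has height at least
          \<open>p ^ a k\<close>; the upper growth bound turns \<open>M <= a (Suc k)\<close> into
          \<open>M / D <= a k\<close>.\<close>
        have "real (a (Suc k)) \<le> D * real (a k)" using growth(2)[of k] step.hyps by simp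
        hence "real M / D \<le> real (a k)" using step.prems(1) D
          by (simp add: divide_le_eq mult.commute)
        hence "real p powr (real M / D) \<le> real p powr real (a k)" using p1 by (intro powr_mono) auto
        also have "\<dots> = real p ^ a k" using p1 by (simp add: powr_realpow)
        also have "\<dots> \<le> real_of_int h"
        proof -
          have "1 * int p ^ a k \<le> \<bar>y\<bar> * psum (Suc k)"
            using y psum_Suc_ge[of k] by (intro mult_mono) auto
          also have "\<dots> = \<bar>x\<bar>" using True psum_nonneg[of "Suc k"] by (simp add: abs_mult)
          finally have "int p ^ a k \<le> h" using h by simp
          hence "real_of_int (int p ^ a k) \<le> real_of_int h" by (simp only: of_int_le_iff)
          thus ?thesis by simp
        qed
        also have "\<dots> \<le> 6 * K * real_of_int h" using K h by (simp add: mult_le_cancel_right1)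
        finally show ?thesis .
      next
        case False
        \<comment> \<open>A nonzero multiple of \<open>p ^ M\<close> has size at least
          \<open>p ^ M\<close>. Comparing sizes loses a factor \<open>2 * p ^ a k\<close>, and
          \<open>a k < M / 2\<close> in this case.\<close>
        hence "int p ^ M \<le> \<bar>x - y * psum (Suc k)\<bar>"
          using step.prems(3) zdvd_imp_le[of "int p ^ M" "\<bar>x - y * psum (Suc k)\<bar>"] by simp
        also have "\<dots> \<le> \<bar>x\<bar> + \<bar>y\<bar> * psum (Suc k)"
          using abs_triangle_ineq4[of x "y * psum (Suc k)"] psum_nonneg[of "Suc k"] by (simp add: abs_mult)
        also have "\<dots> \<le> h + h * psum (Suc k)"
          using psum_nonneg[of "Suc k"] h by (intro add_mono mult_right_mono) auto
        also have "\<dots> = h * (psum (Suc k) + 1)" by (simp add: algebra_simps)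
        also have "\<dots> \<le> h * (2 * int p ^ a k)"
          by (rule mult_left_mono[OF psum_Suc_bound]) (use h in auto)
        finally have "int p ^ M \<le> 2 * h * int p ^ a k" by (simp add: algebra_simps)
        hence "real_of_int (int p ^ M) \<le> real_of_int (2 * h * int p ^ a k)"
          by (simp only: of_int_le_iff)
        hence "real p ^ M \<le> 2 * real_of_int h * real p ^ a k" by simp
        hence "real p powr (real M) \<le> 2 * real_of_int h * real p powr real (a k)"
          using p1 by (simp add: powr_realpow)
        hence le: "real p powr (real M - real (a k)) \<le> 2 * real_of_int h"
          using p1 by (simp add: powr_diff divide_le_eq)
        have "real M / D \<le> real M / 2" using D by (intro divide_left_mono) auto
        also have "\<dots> \<le> real M - real (a k)" using high by simp
        finally have "real p powr (real M / D) \<le> real p powr (real M - real (a k))"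
          using p1 by (intro powr_mono) auto
        also note le
        also have "2 * real_of_int h \<le> 6 * K * real_of_int h" using K h
          by (intro mult_right_mono) auto
        finally show ?thesis .
      qed
    qed
  qed
  thus ?case by (simp add: K_def h_def algebra_simps)
qed

end

section \<open>The linear form as a limit of integers\<close>

context lacunary_padic
begin

lemma padic_abs_of_int:
  assumes "z \<noteq> 0"
  shows "padic_abs_rat p (of_int z) = 1 / real p ^ multiplicity (int p) z"
  using padic_abs_rat_divide[OF p assms, of 1] by (simp add: power_int_minus divide_simps)

lemma padic_abs_of_int_le:
  assumes "int p ^ m dvd z"
  shows "padic_abs_rat p (of_int z) \<le> 1 / real p ^ m"
proof (cases "z = 0")
  case False
  have "m \<le> multiplicity (int p) z"
    using assms False p_ge_2 by (intro multiplicity_geI) auto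
  hence "real p ^ m \<le> real p ^ multiplicity (int p) z"
    using p_ge_2 by (intro power_increasing) auto
  thus ?thesis using p_ge_2 by (simp add: padic_abs_of_int[OF False] frac_le)
qed simp

lemma padic_abs_of_int_gt:
  assumes "\<not> int p ^ m dvd z"
  shows "padic_abs_rat p (of_int z) > 1 / real p ^ m"
proof -
  have z: "z \<noteq> 0" using assms by auto
  have "multiplicity (int p) z < m"
    using assms multiplicity_dvd'[of m "int p" z] by (meson not_le)
  hence "real p ^ multiplicity (int p) z < real p ^ m"
    using p_ge_2 by (intro power_strict_increasing) auto
  thus ?thesis using p_ge_2 by (simp add: padic_abs_of_int[OF z] frac_less2)
qed

text \<open>The \<open>p\<close>-part of \<open>z\<close> divides \<open>z\<close>, so it is at most
  \<open>|z|\<close>. This turns upper bounds on size into lower bounds on the linear form.\<close>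

lemma padic_abs_of_int_ge:
  assumes "z \<noteq> 0"
  shows "padic_abs_rat p (of_int z) \<ge> 1 / real_of_int \<bar>z\<bar>"
proof -
  have "int p ^ multiplicity (int p) z dvd z" by (rule multiplicity_dvd)
  hence "int p ^ multiplicity (int p) z \<le> \<bar>z\<bar>" using assms by (simp add: zdvd_imp_le)
  hence "real p ^ multiplicity (int p) z \<le> real_of_int \<bar>z\<bar>"
    by (metis of_int_le_iff of_int_of_nat_eq of_int_power)
  thus ?thesis using p_ge_2 by (simp add: padic_abs_of_int[OF assms] frac_le)
qed

definition xi :: "(nat \<Rightarrow> rat) set" where
  "xi = padic_suminf p (\<lambda>k. padic_of_rat p (of_nat p ^ a k))"

abbreviation "L \<equiv> padic_lin_form p xi"

lemma a_ge: "k \<le> a k"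
  by (rule strict_mono_imp_increasing[OF a_mono])

lemma inverse_p_tendsto: "(\<lambda>k. 1 / real p ^ a k) \<longlonglongrightarrow> 0"
proof (rule tendsto_sandwich[OF _ _ tendsto_const])
  show "(\<lambda>k. (1 / real p) ^ k) \<longlonglongrightarrow> 0" using p_ge_2 by (intro LIMSEQ_realpow_zero) auto
  show "\<forall>\<^sub>F k in sequentially. 1 / real p ^ a k \<le> (1 / real p) ^ k"
    using p_ge_2 a_ge by (intro always_eventually allI) (simp add: power_divide frac_le power_increasing)
qed auto

text \<open>\<open>xi\<close> is the class of the Cauchy sequence \<open>psum\<close>, and the
  absolute value of a class is the limit along a representative. This reduces questions about
  \<open>L\<close> to divisibility of integers.\<close>

lemma lin_form_tendsto: "(\<lambda>n. padic_abs_rat p (of_int (y * psum n - x))) \<longlonglongrightarrow> L x y"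
proof -
  let ?R = "padic_Cauchy_ring p" and ?K = "padic_field p"
  let ?h = "(+>\<^bsub>?R\<^esub>) (padic_null p)"
  define q where "q = (\<lambda>k. of_nat p ^ a k :: rat)"
  interpret h: ring_hom_cring ?R ?K ?h by (rule padic_coset_hom[OF p])
  have "padic_abs_rat p (q k) \<le> 1 / real p ^ a k" for k
    using padic_abs_of_int_le[of "a k" "int p ^ a k"] by (simp add: q_def)
  hence "(\<lambda>k. padic_abs_rat p (q k)) \<longlonglongrightarrow> 0"
    by (intro tendsto_sandwich[OF _ _ tendsto_const inverse_p_tendsto]) auto
  note sums = padic_sums_of_rat[OF p this]
  have S: "(\<Sum>k<n. q k) = of_int (psum n)" for n by (simp add: q_def psum_def)
  have C: "(\<lambda>n. of_int (psum n)) \<in> carrier ?R" using sums(1) by (simp add: S)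
  have c: "(\<lambda>_. r) \<in> carrier ?R" for r by (rule padic_Cauchy_const)
  have "padic_of_rat p (q k) \<in> carrier ?K" for k
    unfolding padic_of_rat_def by (intro h.hom_closed c)
  hence "padic_suminf p (\<lambda>k. padic_of_rat p (q k)) = ?h (\<lambda>n. of_int (psum n))"
    using sums(2) by (intro padic_suminf_eqI[OF p]) (auto simp: S)
  hence xi: "xi = ?h (\<lambda>n. of_int (psum n))" by (simp add: xi_def q_def)
  have yS: "(\<lambda>n. of_int y * of_int (psum n)) \<in> carrier ?R"
    by (rule padic_Cauchy_mult[OF p c C])
  have "padic_of_rat p (of_int y) \<otimes>\<^bsub>?K\<^esub> xi = ?h (\<lambda>n. of_int y * of_int (psum n))"
    using h.hom_mult[OF c C] by (simp add: xi padic_of_rat_def)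
  hence "padic_of_rat p (of_int y) \<otimes>\<^bsub>?K\<^esub> xi \<ominus>\<^bsub>?K\<^esub> padic_of_rat p (of_int x)
      = ?h (\<lambda>n. of_int y * of_int (psum n) - of_int x)"
    using padic_coset_diff[OF p yS c[of "of_int x"]] by (simp add: padic_of_rat_def)
  moreover have "(\<lambda>n. of_int y * of_int (psum n) - of_int x) \<in> carrier ?R"
    using padic_Cauchy_add[OF p yS c[of "- of_int x"]] by simp
  ultimately show ?thesis
    using padic_abs_tendsto[OF p, of "\<lambda>n. of_int y * of_int (psum n) - of_int x"]
    by (simp add: padic_lin_form_def)
qed

section \<open>Exact values of the linear form\<close>

text \<open>The first term of the tail decides: since \<open>a\<close> is strictly increasing, all
  further terms are divisible by \<open>p ^ Suc (a k)\<close>.\<close>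

lemma psum_tail:
  assumes "k < n"
  shows "padic_abs_rat p (of_int (psum n - psum k)) = 1 / real p ^ a k"
proof -
  have "int p ^ a (Suc k) dvd psum n - psum (Suc k)" using assms by (intro psum_dvd) auto
  moreover have "Suc (a k) \<le> a (Suc k)" using strict_monoD[OF a_mono, of k "Suc k"] by simp
  ultimately have tail: "int p ^ Suc (a k) dvd psum n - psum (Suc k)"
    using power_le_dvd by blast
  have "\<not> int p ^ Suc (a k) dvd psum n - psum k"
  proof
    assume "int p ^ Suc (a k) dvd psum n - psum k"
    from dvd_diff[OF this tail] have "int p ^ Suc (a k) dvd int p ^ a k" by (simp add: psum_Suc)
    hence "int p ^ Suc (a k) \<le> int p ^ a k" using p_ge_2 by (intro zdvd_imp_le) auto
    moreover have "int p ^ a k < int p ^ Suc (a k)"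
      using p_ge_2 by (intro power_strict_increasing) auto
    ultimately show False by simp
  qed
  moreover have "int p ^ a k dvd psum n - psum k" using assms by (intro psum_dvd) auto
  ultimately have "multiplicity (int p) (psum n - psum k) = a k" "psum n - psum k \<noteq> 0"
    by (auto intro!: multiplicity_eqI)
  thus ?thesis using padic_abs_of_int by metis
qed

lemma lin_form_psum: "L (y * psum k) y = padic_abs_rat p (of_int y) / real p ^ a k"
proof -
  have "padic_abs_rat p (of_int (y * psum n - y * psum k)) = padic_abs_rat p (of_int y) / real p ^ a k"
    if "n > k" for n
    using psum_tail[OF that] padic_abs_rat_mult[OF p, of "of_int y" "of_int (psum n - psum k)"]
    by (simp add: algebra_simps)
  hence "(\<lambda>n. padic_abs_rat p (of_int (y * psum n - y * psum k)))
      \<longlonglongrightarrow> padic_abs_rat p (of_int y) / real p ^ a k"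
    by (intro tendsto_eventually eventually_mono[OF eventually_gt_at_top[of k]])
  thus ?thesis using lin_form_tendsto[of y "y * psum k"] LIMSEQ_unique by blast
qed

text \<open>The value at \<open>k\<close> exceeds \<open>1 / p ^ a k\<close>, while replacing
  \<open>psum k\<close> by a later \<open>psum n\<close> adds a term of absolute value at most
  \<open>1 / p ^ a k\<close>. By the ultrametric inequality the sequence is constant from
  \<open>k\<close> on.\<close>

lemma lin_form_eq:
  assumes "\<not> int p ^ a k dvd y * psum k - x"
  shows "L x y = padic_abs_rat p (of_int (y * psum k - x))"
proof -
  have "padic_abs_rat p (of_int (y * psum n - x)) = padic_abs_rat p (of_int (y * psum k - x))"
    (is "?n = ?k") if "n \<ge> k" for n
  proof -
    define r where "r = y * (psum n - psum k)"
    have "int p ^ a k dvd r" unfolding r_def using psum_dvd[OF that] by simp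
    hence r: "padic_abs_rat p (of_int r) < ?k"
      using padic_abs_of_int_le[of "a k" r] padic_abs_of_int_gt[OF assms] by linarith
    have "?n = padic_abs_rat p (of_int (y * psum k - x) + of_int r)"
      by (simp add: r_def algebra_simps)
    also have "\<dots> \<le> max ?k (padic_abs_rat p (of_int r))" by (rule padic_abs_rat_add_le[OF p])
    finally have 1: "?n \<le> ?k" using r by simp
    have "?k = padic_abs_rat p (of_int (y * psum n - x) + - of_int r)"
      by (simp add: r_def algebra_simps)
    also have "\<dots> \<le> max ?n (padic_abs_rat p (- of_int r))" by (rule padic_abs_rat_add_le[OF p])
    finally have "?k \<le> ?n" using r by (simp add: padic_abs_rat_minus[OF p])
    with 1 show ?thesis by simp
  qed
  hence "(\<lambda>n. padic_abs_rat p (of_int (y * psum n - x)))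
      \<longlonglongrightarrow> padic_abs_rat p (of_int (y * psum k - x))"
    by (intro tendsto_eventually eventually_sequentiallyI)
  thus ?thesis using lin_form_tendsto[of y x] LIMSEQ_unique by blast
qed

text \<open>Take the least index at which \<open>p ^ a k\<close> fails to divide
  \<open>y * psum k - x\<close>: without one the form would vanish, and it is not 0 because
  \<open>p ^ a 0 = 1\<close>. The result has the shape that \<open>height_lower_bound\<close>
  expects at \<open>Suc k\<close>.\<close>

lemma lin_form_cases:
  assumes "L x y > 0"
  obtains k m where "a k \<le> m" "m < a (Suc k)" "int p ^ m dvd x - y * psum (Suc k)"
    "L x y = 1 / real p ^ m"
proof -
  have "\<exists>k. \<not> int p ^ a k dvd y * psum k - x"
  proof (rule ccontr)
    assume "\<not> ?thesis"
    hence "padic_abs_rat p (of_int (y * psum k - x)) \<le> 1 / real p ^ a k" for k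
      by (intro padic_abs_of_int_le) auto
    hence "(\<lambda>k. padic_abs_rat p (of_int (y * psum k - x))) \<longlonglongrightarrow> 0"
      by (intro tendsto_sandwich[OF _ _ tendsto_const inverse_p_tendsto]) auto
    hence "L x y = 0" using lin_form_tendsto[of y x] LIMSEQ_unique by blast
    thus False using assms by simp
  qed
  then obtain k where k: "\<not> int p ^ a k dvd y * psum k - x"
    "\<And>i. i < k \<Longrightarrow> int p ^ a i dvd y * psum i - x"
    using exists_least_iff[of "\<lambda>k. \<not> int p ^ a k dvd y * psum k - x"] by blast
  have "k \<noteq> 0"
  proof
    assume "k = 0"
    thus False using k(1) a_0 by simp
  qed
  then obtain i where i: "k = Suc i" by (cases k) auto
  define z where "z = y * psum (Suc i) - x"
  have "z \<noteq> 0" using k(1) by (auto simp: z_def i)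
  define m where "m = multiplicity (int p) z"
  \<comment> \<open>Passing from \<open>psum i\<close> to \<open>psum (Suc i)\<close> adds a
    multiple of \<open>p ^ a i\<close>, so minimality yields the lower end
    \<open>a i <= m\<close>.\<close>
  have "z = (y * psum i - x) + y * int p ^ a i" by (simp add: z_def psum_Suc algebra_simps)
  hence "int p ^ a i dvd z" using k(2)[of i] i by simp
  hence "a i \<le> m" unfolding m_def using \<open>z \<noteq> 0\<close> p_ge_2 by (intro multiplicity_geI) auto
  moreover have "m < a (Suc i)"
    using k(1) multiplicity_dvd'[of "a (Suc i)" "int p" z] unfolding m_def i z_def by (meson not_le)
  moreover have "int p ^ m dvd x - y * psum (Suc i)"
    using multiplicity_dvd[of "int p" z] unfolding m_def z_def by (simp add: dvd_diff_commute)
  moreover have "L x y = 1 / real p ^ m"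
    using lin_form_eq[OF k(1)] padic_abs_of_int[OF \<open>z \<noteq> 0\<close>] by (simp add: i m_def z_def)
  ultimately show ?thesis by (rule that)
qed

end

section \<open>Bounds for the approximations\<close>

context lacunary_padic
begin

lemma psum_Suc_le_powr: "real_of_int (psum (Suc k)) + 1 \<le> real p powr (real (a k) + 1)"
proof -
  have "psum (Suc k) + 1 \<le> 2 * int p ^ a k" by (rule psum_Suc_bound)
  also have "\<dots> \<le> int p * int p ^ a k" using p_ge_2 by (intro mult_right_mono) auto
  finally have "psum (Suc k) + 1 \<le> int p * int p ^ a k" .
  hence "real_of_int (psum (Suc k) + 1) \<le> real_of_int (int p * int p ^ a k)"
    by (simp only: of_int_le_iff)
  thus ?thesis using p_ge_2 by (simp add: powr_add powr_realpow mult.commute)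
qed

lemma powr_le_psum_Suc: "real p powr real (a k) \<le> real_of_int (psum (Suc k))"
proof -
  have "real_of_int (int p ^ a k) \<le> real_of_int (psum (Suc k))"
    using psum_Suc_ge[of k] by (simp only: of_int_le_iff)
  thus ?thesis using p_ge_2 by (simp add: powr_realpow)
qed

lemma psum_Suc_pos: "psum (Suc k) > 0"
proof -
  have "0 < int p ^ a k" using p_ge_2 by simp
  thus ?thesis using psum_Suc_ge[of k] by linarith
qed

lemma lin_form_psum_1: "L (psum (Suc k)) 1 = real p powr (- real (a (Suc k)))"
  using lin_form_psum[of 1 "Suc k"] p_ge_2 by (simp add: powr_minus powr_realpow divide_inverse)

text \<open>Exponential growth of \<open>a\<close> lets \<open>p powr (\<delta> * a k)\<close>
  outgrow the loss \<open>6 ^ k\<close> in \<open>height_lower_bound\<close>.\<close>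

lemma growth_exponential:
  assumes growth: "\<And>i. i \<ge> k0 \<Longrightarrow> 2 * a i \<le> a (Suc i)"
  shows "2 ^ j \<le> a (Suc k0 + j)"
proof (induction j)
  case 0
  show ?case using a_ge[of "Suc k0"] by simp
next
  case (Suc j)
  thus ?case using growth[of "Suc k0 + j"] by simp
qed

section \<open>Finiteness of good approximations\<close>

text \<open>A solution with \<open>L x y = 1 / p ^ m\<close> has height at most
  \<open>p powr (m / \<mu>)\<close>, but at least \<open>p powr (m / D)\<close> up to the factor
  \<open>K * 6 ^ Suc k\<close>. The gap \<open>\<delta> * m\<close> beats this factor for large
  \<open>k\<close>, so \<open>k\<close>, \<open>m\<close> and the height are bounded.\<close>

lemma finite_approximations:
  fixes D \<mu> :: real and k0 :: nat
  assumes D: "D \<ge> 2" "\<mu> > D" and growth: "\<And>i. i \<ge> k0 \<Longrightarrow> 2 * a i \<le> a (Suc i)"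
    "\<And>i. i \<ge> k0 \<Longrightarrow> real (a (Suc i)) \<le> D * real (a i)"
  shows "finite {(x :: int, y :: int). x \<noteq> 0 \<and> y \<noteq> 0 \<and> 0 < L x y \<and>
    L x y \<le> real_of_int (max \<bar>x\<bar> \<bar>y\<bar>) powr (- \<mu>)}"
proof -
  have p1: "real p \<ge> 1" "real p > 1" "real p > 0" using p_ge_2 by auto
  define \<delta> where "\<delta> = 1 / D - 1 / \<mu>"
  have \<delta>: "\<delta> > 0" using D by (simp add: \<delta>_def divide_strict_left_mono)
  define K where "K = real p ^ a (Suc k0)"
  have K: "K \<ge> 1" using p1 by (simp add: K_def)
  \<comment> \<open>The denominator undoes the index shift in \<open>growth_exponential\<close>:
    \<open>c * 2 ^ k = \<delta> * 2 ^ (k - Suc k0)\<close>.\<close>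
  define c where "c = \<delta> / 2 ^ Suc k0"
  have "c > 0" using \<delta> by (simp add: c_def)
  \<comment> \<open>Enlarging 6 to \<open>8 = 2 ^ 3\<close> and \<open>K\<close> to
    \<open>K ^ Suc k\<close> gives a power of 2 with exponent linear in \<open>k\<close>.\<close>
  define C where "C = log 2 K + 3"
  have expK: "K * 6 ^ Suc k \<le> 2 powr (C * real (Suc k))" for k
  proof -
    have "log 2 K * 1 \<le> log 2 K * real (Suc k)" using K by (intro mult_left_mono) auto
    hence "2 powr (log 2 K) * 2 powr (3 * real (Suc k)) \<le> 2 powr (C * real (Suc k))"
      by (simp add: C_def algebra_simps flip: powr_add)
    moreover have "2 powr (3 * real (Suc k)) = (8::real) ^ Suc k"
      using powr_powr[of 2 3 "real (Suc k)"] by (simp add: powr_realpow del: of_nat_Suc)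
    moreover have "2 powr (log 2 K) = K" using K by simp
    ultimately have "K * 8 ^ Suc k \<le> 2 powr (C * real (Suc k))" by simp
    moreover have "K * 6 ^ Suc k \<le> K * 8 ^ Suc k" using K by (intro mult_left_mono power_mono) auto
    ultimately show ?thesis by linarith
  qed
  have "\<forall>\<^sub>F k in sequentially. C * real (Suc k) < c * 2 ^ k" using \<open>c > 0\<close> by real_asymp
  hence "\<forall>\<^sub>F k in sequentially. K * 6 ^ Suc k < 2 powr (c * 2 ^ k)"
  proof eventually_elim
    case (elim k)
    hence "2 powr (C * real (Suc k)) < 2 powr (c * 2 ^ k)" by (intro powr_less_mono) auto
    with expK[of k] show ?case by (rule le_less_trans)
  qed
  then obtain k1 where k1: "\<And>k. k \<ge> k1 \<Longrightarrow> K * 6 ^ Suc k < 2 powr (c * 2 ^ k)"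
    by (auto simp: eventually_sequentially)
  define k2 where "k2 = max (Suc k0) k1"
  have large: "K * 6 ^ Suc k < real p powr (\<delta> * real (a k))" if k: "k \<ge> k2" for k
  proof -
    have "2 ^ (k - Suc k0) \<le> a k"
      using growth_exponential[of k0 "k - Suc k0"] growth(1) k by (simp add: k2_def)
    hence "real (2 ^ (k - Suc k0)) \<le> real (a k)" by (simp only: of_nat_le_iff)
    hence "(2::real) ^ (k - Suc k0) \<le> real (a k)" by simp
    hence "\<delta> * 2 ^ (k - Suc k0) \<le> \<delta> * real (a k)" using \<delta> by simp
    moreover have "c * 2 ^ k = \<delta> * 2 ^ (k - Suc k0)"
      using k by (simp add: c_def k2_def power_diff)
    ultimately have le: "c * 2 ^ k \<le> \<delta> * real (a k)" by simp
    have "K * 6 ^ Suc k < 2 powr (c * 2 ^ k)" using k1 k by (simp add: k2_def)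
    also have "\<dots> \<le> 2 powr (\<delta> * real (a k))" using le by (intro powr_mono) auto
    also have "\<dots> \<le> real p powr (\<delta> * real (a k))" using p_ge_2 \<delta> by (intro powr_mono2) auto
    finally show ?thesis .
  qed
  have bounded: "max \<bar>x\<bar> \<bar>y\<bar> \<le> int p ^ a k2"
    if xy: "x \<noteq> 0" "y \<noteq> 0" "0 < L x y" "L x y \<le> real_of_int (max \<bar>x\<bar> \<bar>y\<bar>) powr (- \<mu>)" for x y
  proof -
    obtain k m where km: "a k \<le> m" "m < a (Suc k)" "int p ^ m dvd x - y * psum (Suc k)"
      "L x y = 1 / real p ^ m" using lin_form_cases[OF xy(3)] by blast
    define N where "N = real_of_int (max \<bar>x\<bar> \<bar>y\<bar>)"
    have N: "N \<ge> 1" unfolding N_def using xy(1) by linarith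
    have "1 / real p powr real m \<le> 1 / N powr \<mu>"
      using xy(4) p1 N by (simp add: km N_def powr_minus powr_realpow divide_inverse)
    hence "N powr \<mu> \<le> real p powr real m" using N p1 by (simp add: divide_simps split: if_splits)
    hence "(N powr \<mu>) powr (1 / \<mu>) \<le> (real p powr real m) powr (1 / \<mu>)"
      using D by (intro powr_mono2) auto
    hence Nle: "N \<le> real p powr (real m / \<mu>)" using D N by (simp add: powr_powr)
    have "k < k2"
    proof (rule ccontr)
      assume "\<not> k < k2"
      hence k: "k \<ge> k2" "k \<ge> Suc k0" by (auto simp: k2_def)
      have "real p powr (real m / D) \<le> K * 6 ^ Suc k * N"
        unfolding K_def N_def
        by (rule height_lower_bound[OF D(1) growth _ _ _ km(3)]) (use k km xy in auto)
      also have "\<dots> \<le> K * 6 ^ Suc k * real p powr (real m / \<mu>)"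
        using Nle K by (intro mult_left_mono) auto
      finally have "real p powr (real m / D - real m / \<mu>) \<le> K * 6 ^ Suc k"
        using p1 by (simp add: powr_diff divide_le_eq)
      moreover have "real m / D - real m / \<mu> = \<delta> * real m" by (simp add: \<delta>_def algebra_simps)
      moreover have "real p powr (\<delta> * real (a k)) \<le> real p powr (\<delta> * real m)"
        using p1 km \<delta> by (intro powr_mono mult_left_mono) auto
      ultimately show False using large[OF k(1)] by simp
    qed
    hence "m \<le> a k2" using km strict_mono_leD[OF a_mono, of "Suc k" k2] by simp
    moreover have "real m / \<mu> \<le> real m" using D by (simp add: divide_le_eq mult_le_cancel_left1)
    ultimately have "real p powr (real m / \<mu>) \<le> real p powr real (a k2)"
      using p1 by (intro powr_mono) auto
    with Nle have "N \<le> real p ^ a k2" using p1 by (simp add: powr_realpow)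
    hence "real_of_int (max \<bar>x\<bar> \<bar>y\<bar>) \<le> real_of_int (int p ^ a k2)" by (simp add: N_def)
    thus ?thesis by (simp only: of_int_le_iff)
  qed
  have "{(x, y). x \<noteq> 0 \<and> y \<noteq> 0 \<and> 0 < L x y \<and> L x y \<le> real_of_int (max \<bar>x\<bar> \<bar>y\<bar>) powr (- \<mu>)}
      \<subseteq> {- (int p ^ a k2)..int p ^ a k2} \<times> {- (int p ^ a k2)..int p ^ a k2}"
  proof (intro subsetI)
    fix z assume mem: "z \<in> {(x, y). x \<noteq> 0 \<and> y \<noteq> 0 \<and> 0 < L x y \<and>
      L x y \<le> real_of_int (max \<bar>x\<bar> \<bar>y\<bar>) powr (- \<mu>)}"
    obtain x y where z: "z = (x, y)" by (cases z)
    have "x \<noteq> 0" "y \<noteq> 0" "0 < L x y" "L x y \<le> real_of_int (max \<bar>x\<bar> \<bar>y\<bar>) powr (- \<mu>)"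
      using mem unfolding z mem_Collect_eq prod.case by blast+
    from bounded[OF this] have "\<bar>x\<bar> \<le> int p ^ a k2" "\<bar>y\<bar> \<le> int p ^ a k2" by simp_all
    thus "z \<in> {- (int p ^ a k2)..int p ^ a k2} \<times> {- (int p ^ a k2)..int p ^ a k2}"
      unfolding z abs_le_iff by auto
  qed
  thus ?thesis by (rule finite_subset) simp
qed

section \<open>Approximation by partial sums\<close>

lemma frequently_good_approximations:
  fixes D \<mu> :: real
  assumes \<mu>: "0 \<le> \<mu>" "\<mu> < D" and D: "\<exists>\<^sub>F k in sequentially. D * real (a k) < real (a (Suc k))"
  shows "\<exists>\<^sub>F k in sequentially. L (psum (Suc k)) 1 \<le> real_of_int (psum (Suc k)) powr (- \<mu>)"
proof -
  have "\<forall>\<^sub>F k in sequentially. k \<ge> nat \<lceil>\<mu> / (D - \<mu>)\<rceil>" by (rule eventually_ge_at_top)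
  with D have "\<exists>\<^sub>F k in sequentially. D * real (a k) < real (a (Suc k)) \<and> k \<ge> nat \<lceil>\<mu> / (D - \<mu>)\<rceil>"
    by (rule frequently_eventually_frequently)
  thus ?thesis
  proof (rule frequently_elim1)
    fix k assume k: "D * real (a k) < real (a (Suc k)) \<and> k \<ge> nat \<lceil>\<mu> / (D - \<mu>)\<rceil>"
    \<comment> \<open>The surplus \<open>(D - \<mu>) * a k\<close> must pay for the extra 1 in the
      exponent of \<open>psum_Suc_le_powr\<close>.\<close>
    have "\<mu> / (D - \<mu>) \<le> real k" using k by linarith
    also have "\<dots> \<le> real (a k)" using a_ge by simp
    finally have "\<mu> \<le> real (a k) * (D - \<mu>)" using \<mu> by (simp add: divide_le_eq)
    hence "\<mu> * (real (a k) + 1) \<le> real (a (Suc k))" using k by (simp add: algebra_simps)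
    hence "real p powr (- real (a (Suc k))) \<le> real p powr (- (\<mu> * (real (a k) + 1)))"
      using p_ge_2 by (intro powr_mono) auto
    also have "\<dots> = (real p powr (real (a k) + 1)) powr (- \<mu>)"
      by (simp add: powr_powr mult.commute)
    also have "\<dots> \<le> real_of_int (psum (Suc k)) powr (- \<mu>)"
      using psum_Suc_le_powr[of k] psum_Suc_pos[of k] \<mu> by (intro powr_mono2') auto
    finally show "L (psum (Suc k)) 1 \<le> real_of_int (psum (Suc k)) powr (- \<mu>)"
      by (simp add: lin_form_psum_1)
  qed
qed

text \<open>The pairs \<open>(psum (Suc k), 1)\<close> serve both sets: for \<open>y = 1\<close> the
  quantity \<open>sqrt |x * y|\<close> is the square root of the height, which doubles the
  exponent.\<close>

lemma infinite_approximations: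
  fixes D \<mu> :: real
  assumes \<mu>: "0 \<le> \<mu>" "\<mu> < D" and D: "\<exists>\<^sub>F k in sequentially. D * real (a k) < real (a (Suc k))"
  shows "infinite {(x :: int, y :: int). x \<noteq> 0 \<and> y \<noteq> 0 \<and> 0 < L x y \<and>
      L x y \<le> real_of_int (max \<bar>x\<bar> \<bar>y\<bar>) powr (- \<mu>)}" (is "infinite ?A")
    and "infinite {(x :: int, y :: int). x \<noteq> 0 \<and> y \<noteq> 0 \<and> 0 < L x y \<and>
      L x y \<le> sqrt (real_of_int \<bar>x * y\<bar>) powr (- (2 * \<mu>))}" (is "infinite ?B")
proof -
  define K where "K = {k. L (psum (Suc k)) 1 \<le> real_of_int (psum (Suc k)) powr (- \<mu>)}"
  have inf: "infinite K"
    using frequently_good_approximations[OF assms]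
    by (simp add: K_def frequently_cofinite[symmetric] cofinite_eq_sequentially)
  have "strict_mono psum" by (rule strict_monoI_Suc) (use p_ge_2 in \<open>simp add: psum_Suc\<close>)
  hence "inj (\<lambda>k. (psum (Suc k), 1 :: int))"
    by (auto simp: inj_on_def strict_mono_eq)
  hence img: "infinite ((\<lambda>k. (psum (Suc k), 1 :: int)) ` K)"
    using inf finite_imageD inj_on_subset by blast
  have nz: "psum (Suc k) \<noteq> 0 \<and> (1::int) \<noteq> 0 \<and> 0 < L (psum (Suc k)) 1" for k
    using psum_Suc_pos[of k] p_ge_2 by (simp add: lin_form_psum_1)
  have "(\<lambda>k. (psum (Suc k), 1 :: int)) ` K \<subseteq> ?A"
  proof -
    have "max \<bar>psum (Suc k)\<bar> \<bar>1\<bar> = psum (Suc k)" for k using psum_Suc_pos[of k] by simp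
    thus ?thesis using nz unfolding K_def by auto
  qed
  thus "infinite ?A" using img infinite_super by blast
  have "(\<lambda>k. (psum (Suc k), 1 :: int)) ` K \<subseteq> ?B"
  proof -
    have "sqrt (real_of_int \<bar>psum (Suc k) * 1\<bar>) powr (- (2 * \<mu>)) = real_of_int (psum (Suc k)) powr (- \<mu>)" for k
      using psum_Suc_pos[of k] by (simp add: powr_half_sqrt[symmetric] powr_powr)
    thus ?thesis using nz unfolding K_def by auto
  qed
  thus "infinite ?B" using img infinite_super by blast
qed

section \<open>Bounds for uniform approximation\<close>

text \<open>For \<open>X = p powr t\<close> take \<open>p ^ j * (psum (Suc k), 1)\<close> with
  \<open>a k + 1 <= 2 * t < a (Suc k) + 1\<close> and \<open>j\<close> about
  \<open>t - a k / 2\<close>. The valuation is \<open>j + a (Suc k)\<close>; for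
  \<open>2 * t\<close> near \<open>a (Suc k)\<close> its ratio to \<open>t\<close> is about
  \<open>3 - a k / a (Suc k)\<close>.\<close>

lemma uniform_approximations:
  fixes D \<mu> :: real
  assumes \<mu>: "1 \<le> \<mu>" "\<mu> < 3 - 1 / D" and D: "D > 1"
    "\<forall>\<^sub>F k in sequentially. D * real (a k) < real (a (Suc k))"
  shows "\<forall>\<^sub>F X :: real in at_top. \<exists>x y :: int.
       0 < sqrt (real_of_int \<bar>x * y\<bar>) \<and> sqrt (real_of_int \<bar>x * y\<bar>) \<le> X \<and> L x y \<le> X powr (- \<mu>)"
proof -
  have p1: "real p \<ge> 1" "real p > 1" "real p > 0" using p_ge_2 by auto
  obtain k0 where k0: "\<And>k. k \<ge> k0 \<Longrightarrow> D * real (a k) < real (a (Suc k))"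
    using D(2) by (auto simp: eventually_sequentially)
  define \<eta> where "\<eta> = 3 - 1 / D - \<mu>"
  have \<eta>: "\<eta> > 0" using \<mu> by (simp add: \<eta>_def)
  \<comment> \<open>\<open>\<mu> + 2\<close> collects the cost of rounding \<open>j\<close> and of
    the \<open>+ 1\<close> in the window for \<open>2 * t\<close>; it is to be covered by
    \<open>\<eta> * a (Suc k)\<close>.\<close>
  define k1 where "k1 = max k0 (nat \<lceil>(\<mu> + 2) / \<eta>\<rceil>)"
  have "\<forall>\<^sub>F X in at_top. X \<ge> real p powr (real (a k1) + 1)" by (rule eventually_ge_at_top)
  thus ?thesis
  proof (rule eventually_mono)
    fix X :: real assume X: "X \<ge> real p powr (real (a k1) + 1)"
    hence X0: "X > 0" using p1 by (smt (verit) powr_gt_zero)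
    define t where "t = log (real p) X"
    have Xt: "X = real p powr t" using X0 p1 by (simp add: t_def)
    have t: "t \<ge> real (a k1) + 1" using X p1 unfolding Xt by simp
    have "\<exists>n. 2 * t < real (a n) + 1"
    proof
      have "2 * t \<le> real (nat \<lceil>2 * t\<rceil>)" by linarith
      also have "\<dots> \<le> real (a (nat \<lceil>2 * t\<rceil>))" using a_ge by simp
      finally show "2 * t < real (a (nat \<lceil>2 * t\<rceil>)) + 1" by simp
    qed
    then obtain n where n: "2 * t < real (a n) + 1" "\<And>i. i < n \<Longrightarrow> \<not> 2 * t < real (a i) + 1"
      using exists_least_iff[of "\<lambda>n. 2 * t < real (a n) + 1"] by blast
    have "a k1 < a n" using n(1) t by linarith
    hence "k1 < n" using strict_mono_less[OF a_mono] by simp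
    then obtain k where k: "n = Suc k" "k1 \<le> k" by (cases n) auto
    have lo: "real (a k) + 1 \<le> 2 * t" using n(2)[of k] k by simp
    have hi: "2 * t < real (a (Suc k)) + 1" using n(1) k by simp
    \<comment> \<open>the largest multiple by a power of \<open>p\<close> that still fits under \<open>X\<close>\<close>
    define j where "j = nat \<lfloor>t - (real (a k) + 1) / 2\<rfloor>"
    have "t - (real (a k) + 1) / 2 \<ge> 0" using lo by simp
    hence j: "real j \<le> t - (real (a k) + 1) / 2" "t - (real (a k) + 1) / 2 - 1 \<le> real j"
      unfolding j_def by linarith+
    define x y where "x = int p ^ j * psum (Suc k)" and "y = int p ^ j"
    have xy: "real_of_int \<bar>x * y\<bar> = real p powr (2 * real j) * real_of_int (psum (Suc k))"
    proof -
      have "real p powr (2 * real j) = real p ^ j * real p ^ j"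
        using p1 by (simp add: powr_realpow[symmetric] flip: powr_add)
      thus ?thesis using psum_nonneg[of "Suc k"] by (simp add: x_def y_def abs_mult)
    qed
    have "x * y \<noteq> 0" using psum_Suc_pos[of k] p_ge_2 by (simp add: x_def y_def)
    hence pos: "0 < sqrt (real_of_int \<bar>x * y\<bar>)" by simp
    have "real_of_int \<bar>x * y\<bar> \<le> real p powr (2 * real j) * real p powr (real (a k) + 1)"
      unfolding xy using psum_Suc_le_powr[of k] by (intro mult_left_mono) auto
    also have "\<dots> = real p powr (2 * real j + (real (a k) + 1))" by (simp add: powr_add)
    also have "\<dots> \<le> real p powr (t + t)" using j(1) p1(1) by (intro powr_mono) (simp_all add: field_simps)
    also have "\<dots> = X\<^sup>2" by (simp add: Xt power2_eq_square flip: powr_add)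
    finally have le: "sqrt (real_of_int \<bar>x * y\<bar>) \<le> X" using X0 by (simp add: real_le_lsqrt)
    have "L x y = padic_abs_rat p (of_int (int p ^ j)) / real p ^ a (Suc k)"
      unfolding x_def y_def by (rule lin_form_psum)
    also have "\<dots> \<le> 1 / real p ^ j / real p ^ a (Suc k)"
      using padic_abs_of_int_le[of j "int p ^ j"] by (intro divide_right_mono) auto
    also have "\<dots> = real p powr (- (real j + real (a (Suc k))))"
      using p1 by (simp add: powr_add powr_realpow powr_minus powr_diff divide_simps)
    also have "\<dots> \<le> real p powr (- (\<mu> * t))"
    proof -
      have "(\<mu> + 2) / \<eta> \<le> real k1" unfolding k1_def by linarith
      also have "real k1 \<le> real (Suc k)" using k by simp
      also have "real (Suc k) \<le> real (a (Suc k))" using a_ge[of "Suc k"] by simp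
      finally have "\<mu> + 2 \<le> \<eta> * real (a (Suc k))" using \<eta> by (simp add: divide_le_eq mult.commute)
      moreover have "real (a k) \<le> real (a (Suc k)) / D"
        using k0[of k] k D(1) by (simp add: k1_def le_divide_eq mult.commute)
      ultimately have 1: "\<mu> + 2 \<le> (3 - \<mu>) * real (a (Suc k)) - real (a k)"
        by (simp add: \<eta>_def algebra_simps)
      \<comment> \<open>\<open>\<mu> >= 1\<close> makes the right end of the window the worst
        case.\<close>
      have "(\<mu> - 1) * (2 * t) \<le> (\<mu> - 1) * (real (a (Suc k)) + 1)"
        using hi \<mu> by (intro mult_left_mono) auto
      hence "2 * (\<mu> * t) \<le> 2 * t + (\<mu> - 1) * (real (a (Suc k)) + 1)" by (simp add: algebra_simps)
      also have "\<dots> \<le> 2 * (real j + real (a (Suc k)))" using 1 j by (simp add: field_simps)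
      finally have "\<mu> * t \<le> real j + real (a (Suc k))" by simp
      thus ?thesis using p1 by (intro powr_mono) auto
    qed
    also have "\<dots> = X powr (- \<mu>)" by (simp add: Xt powr_powr mult.commute)
    finally show "\<exists>x y :: int. 0 < sqrt (real_of_int \<bar>x * y\<bar>) \<and> sqrt (real_of_int \<bar>x * y\<bar>) \<le> X
        \<and> L x y \<le> X powr (- \<mu>)" using pos le by blast
  qed
qed

text \<open>For the chosen \<open>X\<close>, a multiple of \<open>(psum (Suc k), 1)\<close> has
  \<open>y\<close> too small to make the form small enough. For any other pair the form is the
  absolute value of the nonzero integer \<open>z = y * psum (Suc k) - x\<close>, hence at least
  \<open>1 / |z|\<close>.\<close>

lemma no_uniform_approximations:
  fixes D \<mu> :: real
  assumes D: "D > 1" "\<exists>\<^sub>F k in sequentially. D * real (a k) < real (a (Suc k))"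
    and growth: "\<forall>\<^sub>F k in sequentially. 2 * a k \<le> a (Suc k)" and \<mu>: "\<mu> > 3 + 1 / (D - 1)"
  shows "\<not> (\<forall>\<^sub>F X :: real in at_top. \<exists>x y :: int.
       0 < sqrt (real_of_int \<bar>x * y\<bar>) \<and> sqrt (real_of_int \<bar>x * y\<bar>) \<le> X \<and> L x y \<le> X powr (- \<mu>))"
proof
  assume "\<forall>\<^sub>F X :: real in at_top. \<exists>x y :: int.
       0 < sqrt (real_of_int \<bar>x * y\<bar>) \<and> sqrt (real_of_int \<bar>x * y\<bar>) \<le> X \<and> L x y \<le> X powr (- \<mu>)"
  then obtain X0 where X0: "\<And>X. X \<ge> X0 \<Longrightarrow> \<exists>x y :: int.
       0 < sqrt (real_of_int \<bar>x * y\<bar>) \<and> sqrt (real_of_int \<bar>x * y\<bar>) \<le> X \<and> L x y \<le> X powr (- \<mu>)"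
    by (auto simp: eventually_at_top_linorder)
  have p1: "real p \<ge> 1" "real p > 1" "real p > 0" using p_ge_2 by auto
  define \<eta> where "\<eta> = \<mu> - 3 - 1 / (D - 1)"
  have \<eta>: "\<eta> > 0" using \<mu> by (simp add: \<eta>_def)
  have \<mu>3: "\<mu> > 3" using \<mu> D(1) by (smt (verit) divide_pos_pos)
  have "\<forall>\<^sub>F k in sequentially. real p powr (real k / 2 - 1) \<ge> X0" using p1 by real_asymp
  moreover have "\<forall>\<^sub>F k in sequentially. real k > 2 * \<mu> / \<eta>" by real_asymp
  ultimately have "\<forall>\<^sub>F k in sequentially. 2 * a k \<le> a (Suc k) \<and> real p powr (real k / 2 - 1) \<ge> X0
      \<and> real k > 2 * \<mu> / \<eta>" using growth by eventually_elim auto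
  from frequently_eventually_frequently[OF D(2) this]
  obtain k where k: "D * real (a k) < real (a (Suc k))" "2 * a k \<le> a (Suc k)"
    "real p powr (real k / 2 - 1) \<ge> X0" "real k > 2 * \<mu> / \<eta>"
    using frequently_ex by blast
  define A B where "A = real (a k)" and "B = real (a (Suc k)) - real (a k)"
  have aS: "real (a (Suc k)) = A + B" by (simp add: A_def B_def)
  have kA: "real k \<le> A" using a_ge by (simp add: A_def)
  have AB: "A \<le> B" using k(2) unfolding A_def B_def by linarith
  \<comment> \<open>\<open>D * a k < a (Suc k)\<close> rewritten for the gap \<open>B\<close>; this
    is the source of \<open>1 / (D - 1)\<close>.\<close>
  have AD: "A \<le> B / (D - 1)" using k(1) D(1) by (simp add: A_def B_def le_divide_eq algebra_simps)
  have "2 * \<mu> / \<eta> < B" using k(4) kA AB by linarith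
  \<comment> \<open>Both cases below lead to \<open>\<mu> * B - 2 * \<mu> < 3 * B + A\<close>, the
    second by \<open>AB\<close>; with \<open>AD\<close> this is excluded.\<close>
  hence big: "2 * \<mu> < (\<mu> - 3) * B - B / (D - 1)" using \<eta> by (simp add: divide_less_eq \<eta>_def algebra_simps)
  \<comment> \<open>For this \<open>X\<close>, a pair with \<open>x \<noteq> y * psum (Suc k)\<close> has \<open>\<bar>x - y * psum (Suc k)\<bar>\<close> below \<open>p ^ a (Suc k)\<close>.\<close>
  define s where "s = B / 2 - 1"
  define X where "X = real p powr s"
  have X: "X > 0" using p1 by (simp add: X_def)
  have "real p powr (real k / 2 - 1) \<le> X"
    unfolding X_def s_def using p1 kA AB by (intro powr_mono) auto
  hence "X \<ge> X0" using k(3) by linarith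
  then obtain x y where xy: "0 < sqrt (real_of_int \<bar>x * y\<bar>)" "sqrt (real_of_int \<bar>x * y\<bar>) \<le> X"
    "L x y \<le> X powr (- \<mu>)" using X0 by blast
  have nz: "x \<noteq> 0" "y \<noteq> 0" using xy(1) by auto
  have "real_of_int \<bar>x * y\<bar> \<le> X\<^sup>2" using xy(2) X by (metis real_sqrt_le_iff real_sqrt_abs abs_of_pos)
  also have "X\<^sup>2 = real p powr (B - 2)" by (simp add: X_def s_def power2_eq_square flip: powr_add)
  finally have prod: "real_of_int \<bar>x * y\<bar> \<le> real p powr (B - 2)" .
  have Xmu: "X powr (- \<mu>) = real p powr (- (\<mu> * s))" by (simp add: X_def powr_powr mult.commute)
  show False
  proof (cases "x = y * psum (Suc k)")
    case True
    have y2: "(real_of_int \<bar>y\<bar>)\<^sup>2 * real p powr A \<le> real p powr (B - 2)"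
    proof -
      have "(real_of_int \<bar>y\<bar>)\<^sup>2 * real p powr A \<le> (real_of_int \<bar>y\<bar>)\<^sup>2 * real_of_int (psum (Suc k))"
        unfolding A_def by (intro mult_left_mono powr_le_psum_Suc) auto
      also have "\<dots> = real_of_int \<bar>x * y\<bar>"
        using psum_Suc_pos[of k] by (simp add: True abs_mult power2_eq_square)
      finally show ?thesis using prod by simp
    qed
    hence "(real_of_int \<bar>y\<bar>)\<^sup>2 \<le> real p powr (B - 2 - A)"
      using p1 by (simp only: powr_diff[of _ "B - 2"] le_divide_eq powr_gt_zero) simp
    also have "\<dots> = (real p powr ((B - 2 - A) / 2))\<^sup>2"
      by (simp add: power2_eq_square flip: powr_add)
    finally have yle: "real_of_int \<bar>y\<bar> \<le> real p powr ((B - 2 - A) / 2)"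
      by (rule power2_le_imp_le) simp
    have "real p powr (- ((B - 2 - A) / 2) - (A + B))
        = 1 / real p powr ((B - 2 - A) / 2) / real p ^ a (Suc k)"
      using p1 by (simp only: powr_diff powr_minus divide_inverse aS[symmetric] powr_realpow mult_1)
    also have "\<dots> \<le> 1 / real_of_int \<bar>y\<bar> / real p ^ a (Suc k)"
      using yle nz p1 by (intro divide_right_mono divide_left_mono mult_pos_pos) auto
    also have "\<dots> \<le> L x y"
      using padic_abs_of_int_ge[OF nz(2)] unfolding True lin_form_psum
      by (intro divide_right_mono) auto
    finally have "real p powr (- ((B - 2 - A) / 2) - (A + B)) \<le> real p powr (- (\<mu> * s))"
      using xy(3) Xmu by simp
    hence "- ((B - 2 - A) / 2) - (A + B) \<le> - (\<mu> * s)" using p1 by simp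
    hence "\<mu> * B - 2 * \<mu> \<le> 3 * B + A - 2" by (simp add: s_def field_simps)
    thus False using big AD by (simp add: algebra_simps)
  next
    case False
    define z where "z = y * psum (Suc k) - x"
    have z0: "z \<noteq> 0" using False by (simp add: z_def)
    have "\<bar>z\<bar> \<le> \<bar>y * psum (Suc k)\<bar> + \<bar>x\<bar>" unfolding z_def by (rule abs_triangle_ineq4)
    also have "\<dots> \<le> \<bar>x * y\<bar> * (psum (Suc k) + 1)"
    proof -
      have "\<bar>y\<bar> * psum (Suc k) \<le> \<bar>x * y\<bar> * psum (Suc k)"
        using nz psum_nonneg[of "Suc k"] by (intro mult_right_mono) (auto simp: abs_mult)
      moreover have "\<bar>x\<bar> \<le> \<bar>x * y\<bar>" using nz by (simp add: abs_mult mult_le_cancel_left1)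
      ultimately show ?thesis using psum_nonneg[of "Suc k"] by (simp add: abs_mult algebra_simps)
    qed
    finally have "real_of_int \<bar>z\<bar> \<le> real_of_int (\<bar>x * y\<bar> * (psum (Suc k) + 1))"
      by (simp only: of_int_le_iff)
    also have "\<dots> = real_of_int \<bar>x * y\<bar> * (real_of_int (psum (Suc k)) + 1)" by simp
    also have "\<dots> \<le> real p powr (B - 2) * real p powr (A + 1)"
      unfolding A_def by (intro mult_mono prod psum_Suc_le_powr) (use psum_nonneg[of "Suc k"] in auto)
    also have "\<dots> = real p powr (A + B - 1)" by (subst powr_add[symmetric]) (simp add: algebra_simps)
    finally have zle: "real_of_int \<bar>z\<bar> \<le> real p powr (A + B - 1)" .
    have "\<not> int p ^ a (Suc k) dvd z"
    proof
      assume "int p ^ a (Suc k) dvd z"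
      hence "int p ^ a (Suc k) \<le> \<bar>z\<bar>" using z0 zdvd_imp_le[of "int p ^ a (Suc k)" "\<bar>z\<bar>"] by simp
      hence "real_of_int (int p ^ a (Suc k)) \<le> real_of_int \<bar>z\<bar>" by (simp only: of_int_le_iff)
      hence "real p powr (A + B) \<le> real_of_int \<bar>z\<bar>" using p1 by (simp add: powr_realpow flip: aS)
      also note zle
      finally show False using p1 by simp
    qed
    hence Lz: "L x y = padic_abs_rat p (of_int z)" unfolding z_def by (rule lin_form_eq)
    have "real p powr (- (A + B - 1)) = 1 / real p powr (A + B - 1)"
      by (simp only: powr_minus divide_inverse mult_1)
    also have "\<dots> \<le> 1 / real_of_int \<bar>z\<bar>" using zle z0 p1 by (intro divide_left_mono mult_pos_pos) auto
    also have "\<dots> \<le> L x y" unfolding Lz by (rule padic_abs_of_int_ge[OF z0])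
    finally have "real p powr (- (A + B - 1)) \<le> real p powr (- (\<mu> * s))" using xy(3) Xmu by simp
    hence "- (A + B - 1) \<le> - (\<mu> * s)" using p1 by simp
    hence "\<mu> * B - 2 * \<mu> \<le> 2 * (A + B - 1)" by (simp add: s_def algebra_simps)
    thus False using big AD AB by (simp add: algebra_simps)
  qed
qed

end

section \<open>The exponents\<close>

lemma ereal_one_divide: "x \<noteq> 0 \<Longrightarrow> 1 / ereal x = ereal (1 / x)"
  by (simp add: one_ereal_def)

theorem theorem2p1:
  fixes p :: nat and a :: "nat \<Rightarrow> nat" and \<xi> :: "(nat \<Rightarrow> rat) set" and c d :: ereal
  assumes "prime p"
    and "strict_mono a"
    and "a 0 = 0"
    and "\<forall>\<^sub>F k in sequentially. a (Suc k) \<ge> 2 * a k"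
  defines "\<xi> \<equiv> padic_suminf p (\<lambda>k. padic_of_rat p (of_nat p ^ a k))"
    and "c \<equiv> liminf (\<lambda>k. ereal (real (a (Suc k)) / real (a k)))"
    and "d \<equiv> limsup (\<lambda>k. ereal (real (a (Suc k)) / real (a k)))"
  shows "irrationality_exponent p \<xi> = d
    \<and> mult_irrationality_exponent p \<xi> = 2 * d
    \<and> 3 - 1 / c \<le> unif_mult_irrationality_exponent p \<xi>
    \<and> unif_mult_irrationality_exponent p \<xi> \<le> 3 + 1 / (d - 1)"
proof -
  interpret lacunary_padic p a by unfold_locales (use assms in auto)
  have xi: "\<xi> = xi" by (simp add: \<xi>_def xi_def)
  \<comment> \<open>The quotient at \<open>k = 0\<close> is a division by zero; all later statements
    about quotients avoid it.\<close>
  have pos: "\<forall>\<^sub>F k in sequentially. a k > 0"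
  proof (rule eventually_mono[OF eventually_gt_at_top[of 0]])
    fix k :: nat assume "0 < k"
    thus "0 < a k" using a_ge[of k] by linarith
  qed
  have ge2: "\<forall>\<^sub>F k in sequentially. ereal 2 \<le> ereal (real (a (Suc k)) / real (a k))"
    using pos assms(4)
  proof eventually_elim
    case (elim k)
    hence "2 * real (a k) \<le> real (a (Suc k))" by linarith
    thus ?case using elim by (simp add: le_divide_eq)
  qed
  have c2: "c \<ge> ereal 2" unfolding c_def by (rule Liminf_bounded[OF ge2])
  have d2: "d \<ge> ereal 2" unfolding d_def by (rule le_Limsup[OF _ ge2]) simp
  have freq: "\<exists>\<^sub>F k in sequentially. D * real (a k) < real (a (Suc k))" if "ereal D < d" for D
  proof (rule ccontr)
    assume "\<not> ?thesis"
    hence "\<forall>\<^sub>F k in sequentially. \<not> D * real (a k) < real (a (Suc k))" by (simp add: frequently_def)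
    with pos have "\<forall>\<^sub>F k in sequentially. ereal (real (a (Suc k)) / real (a k)) \<le> ereal D"
      by eventually_elim (simp add: divide_le_eq)
    hence "d \<le> ereal D" unfolding d_def by (rule Limsup_bounded)
    with that show False by simp
  qed
  have finite_approx: "finite {(x :: int, y :: int). x \<noteq> 0 \<and> y \<noteq> 0 \<and> 0 < L x y \<and>
      L x y \<le> real_of_int (max \<bar>x\<bar> \<bar>y\<bar>) powr (- \<mu>)}" if \<mu>: "d < ereal \<mu>" for \<mu>
  proof -
    \<comment> \<open>An intermediate \<open>D\<close> bounds the quotients eventually and stays
      below \<open>\<mu>\<close>. For infinite \<open>d\<close> the claim is vacuous.\<close>
    obtain D where D: "d < ereal D" "ereal D < ereal \<mu>" using ereal_dense2[OF \<mu>] by auto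
    have "ereal 2 < ereal D" using d2 D(1) by (rule le_less_trans)
    have "\<forall>\<^sub>F k in sequentially. ereal (real (a (Suc k)) / real (a k)) < ereal D"
      using D(1) unfolding d_def by (rule Limsup_lessD)
    with pos assms(4) have "\<forall>\<^sub>F k in sequentially. 2 * a k \<le> a (Suc k) \<and> real (a (Suc k)) \<le> D * real (a k)"
      by eventually_elim (simp add: divide_less_eq)
    then obtain k0 where "\<And>i. i \<ge> k0 \<Longrightarrow> 2 * a i \<le> a (Suc i) \<and> real (a (Suc i)) \<le> D * real (a i)"
      by (auto simp: eventually_sequentially)
    thus ?thesis using D(2) \<open>ereal 2 < ereal D\<close> by (intro finite_approximations[of D \<mu> k0]) auto
  qed
  have "irrationality_exponent p \<xi> \<le> d"
    unfolding irrationality_exponent_def xi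
  proof (rule Sup_least, clarify)
    fix \<mu> :: real
    assume "infinite {(x :: int, y :: int). x \<noteq> 0 \<and> y \<noteq> 0 \<and> 0 < L x y \<and>
      L x y \<le> real_of_int (max \<bar>x\<bar> \<bar>y\<bar>) powr (- \<mu>)}"
    thus "ereal \<mu> \<le> d" using finite_approx[of \<mu>] by (meson not_le)
  qed
  moreover have "mult_irrationality_exponent p \<xi> \<le> 2 * d"
    unfolding mult_irrationality_exponent_def xi
  proof (rule Sup_least, clarify, rule ccontr)
    fix \<mu> :: real
    assume inf: "infinite {(x :: int, y :: int). x \<noteq> 0 \<and> y \<noteq> 0 \<and> 0 < L x y \<and>
      L x y \<le> sqrt (real_of_int \<bar>x * y\<bar>) powr (- \<mu>)}" and "\<not> ereal \<mu> \<le> 2 * d"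
    hence less: "d < ereal (\<mu> / 2)" using d2 by (cases d) auto
    hence "ereal 2 < ereal (\<mu> / 2)" using d2 by (rule le_less_trans[rotated])
    hence \<mu>: "\<mu> > 0" by simp
    have "sqrt (real_of_int \<bar>x * y\<bar>) powr (- \<mu>) \<le> real_of_int (max \<bar>x\<bar> \<bar>y\<bar>) powr (- (\<mu> / 2))"
      if "x \<noteq> 0" "y \<noteq> 0" for x y
    proof -
      have "\<bar>x\<bar> * 1 \<le> \<bar>x\<bar> * \<bar>y\<bar>" "1 * \<bar>y\<bar> \<le> \<bar>x\<bar> * \<bar>y\<bar>"
        using that by (intro mult_left_mono mult_right_mono; simp)+
      hence "max \<bar>x\<bar> \<bar>y\<bar> \<le> \<bar>x * y\<bar>" by (simp add: abs_mult)
      hence le: "real_of_int (max \<bar>x\<bar> \<bar>y\<bar>) \<le> real_of_int \<bar>x * y\<bar>" by (simp only: of_int_le_iff)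
      have "sqrt (real_of_int \<bar>x * y\<bar>) powr (- \<mu>) = real_of_int \<bar>x * y\<bar> powr (- (\<mu> / 2))"
        by (simp add: powr_half_sqrt[symmetric] powr_powr)
      also have "\<dots> \<le> real_of_int (max \<bar>x\<bar> \<bar>y\<bar>) powr (- (\<mu> / 2))"
        using \<mu> that le by (intro powr_mono2') auto
      finally show ?thesis .
    qed
    hence "{(x :: int, y :: int). x \<noteq> 0 \<and> y \<noteq> 0 \<and> 0 < L x y \<and> L x y \<le> sqrt (real_of_int \<bar>x * y\<bar>) powr (- \<mu>)}
      \<subseteq> {(x :: int, y :: int). x \<noteq> 0 \<and> y \<noteq> 0 \<and> 0 < L x y \<and> L x y \<le> real_of_int (max \<bar>x\<bar> \<bar>y\<bar>) powr (- (\<mu> / 2))}"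
      by (auto intro: order_trans)
    thus False using finite_approx[OF less] inf finite_subset by blast
  qed
  \<comment> \<open>The construction needs a nonnegative exponent; replacing \<open>s\<close> by
    \<open>max 0 s\<close> keeps it below \<open>d\<close> because \<open>d >= 2\<close>.\<close>
  moreover have lower: "ereal (max 0 s) \<le> irrationality_exponent p \<xi>"
    "ereal (2 * max 0 s) \<le> mult_irrationality_exponent p \<xi>" if s: "ereal s < d" for s
  proof -
    have "ereal 0 < ereal 2" by simp
    also note d2
    finally have "ereal (max 0 s) < d" using s by (simp add: max_def)
    then obtain D where D: "ereal (max 0 s) < ereal D" "ereal D < d" using ereal_dense2 by blast
    note inf = infinite_approximations[of "max 0 s" D, OF _ _ freq[OF D(2)]]
    show "ereal (max 0 s) \<le> irrationality_exponent p \<xi>"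
      unfolding irrationality_exponent_def xi using inf(1) D(1)
      by (intro Sup_upper CollectI exI[of _ "max 0 s"] conjI refl) auto
    show "ereal (2 * max 0 s) \<le> mult_irrationality_exponent p \<xi>"
      unfolding mult_irrationality_exponent_def xi using inf(2) D(1)
      by (intro Sup_upper CollectI exI[of _ "2 * max 0 s"] conjI refl) auto
  qed
  moreover have "d \<le> irrationality_exponent p \<xi>"
  proof (rule ccontr)
    assume "\<not> ?thesis"
    hence "irrationality_exponent p \<xi> < d" by (simp only: not_le)
    then obtain s where s: "irrationality_exponent p \<xi> < ereal s" "ereal s < d"
      using ereal_dense2 by blast
    have "ereal s \<le> ereal (max 0 s)" by simp
    with lower(1)[OF s(2)] s(1) show False by (meson leD order_trans)
  qed
  moreover have "2 * d \<le> mult_irrationality_exponent p \<xi>"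
  proof (rule ccontr)
    assume "\<not> ?thesis"
    hence "mult_irrationality_exponent p \<xi> < 2 * d" by (simp only: not_le)
    then obtain s where s: "mult_irrationality_exponent p \<xi> < ereal s" "ereal s < 2 * d"
      using ereal_dense2 by blast
    have "ereal (s / 2) < d" using s(2) d2 by (cases d) auto
    note lower(2)[OF this]
    moreover have "ereal s \<le> ereal (2 * max 0 (s / 2))" by simp
    ultimately show False using s(1) by (meson leD order_trans)
  qed
  moreover have "3 - 1 / c \<le> unif_mult_irrationality_exponent p \<xi>"
  proof (rule ccontr)
    assume "\<not> ?thesis"
    hence "unif_mult_irrationality_exponent p \<xi> < 3 - 1 / c" by (simp only: not_le)
    then obtain s where s: "unif_mult_irrationality_exponent p \<xi> < ereal s" "ereal s < 3 - 1 / c"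
      using ereal_dense2 by blast
    \<comment> \<open>\<open>uniform_approximations\<close> needs \<open>\<mu> >= 1\<close>, which
      is harmless: \<open>c >= 2\<close> gives \<open>3 - 1 / c > 1\<close>.\<close>
    define \<mu> where "\<mu> = max 1 s"
    \<comment> \<open>The inequality \<open>\<mu> < 3 - 1 / c\<close> solved for \<open>c\<close>,
      in a form that also covers infinite \<open>c\<close>.\<close>
    have s3: "\<mu> < 3" "ereal (1 / (3 - \<mu>)) < c"
    proof -
      consider (real) r where "c = ereal r" "r \<ge> 2" | (infty) "c = \<infinity>" using c2 by (cases c) auto
      hence "\<mu> < 3 \<and> ereal (1 / (3 - \<mu>)) < c"
      proof cases
        case real
        have "ereal s < ereal (3 - 1 / r)"
          using s(2) real by (simp add: ereal_one_divide numeral_eq_ereal)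
        moreover have "1 / r \<le> 1 / 2" using real(2) by (intro divide_left_mono) auto
        ultimately have m: "\<mu> < 3 - 1 / r" by (simp add: \<mu>_def)
        moreover have "1 / r > 0" using real(2) by simp
        ultimately have "\<mu> < 3" by linarith
        moreover have "1 < r * (3 - \<mu>)" using m real(2) by (simp add: field_simps)
        ultimately show ?thesis using real(1) by (simp add: divide_less_eq)
      next
        case infty
        thus ?thesis using s(2) by (simp add: \<mu>_def numeral_eq_ereal)
      qed
      thus "\<mu> < 3" "ereal (1 / (3 - \<mu>)) < c" by auto
    qed
    have "ereal (max 1 (1 / (3 - \<mu>))) < c"
    proof -
      have "ereal 1 < ereal 2" by simp
      also note c2
      finally show ?thesis using s3(2) by (simp add: max_def)
    qed
    then obtain D where D: "ereal (max 1 (1 / (3 - \<mu>))) < ereal D" "ereal D < c"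
      using ereal_dense2 by blast
    hence D1: "D > 1" "1 / (3 - \<mu>) < D" by auto
    hence "1 < D * (3 - \<mu>)" using s3 by (simp add: divide_less_eq)
    hence \<mu>D: "\<mu> < 3 - 1 / D" using D1 by (simp add: field_simps)
    have "\<forall>\<^sub>F k in sequentially. ereal D < ereal (real (a (Suc k)) / real (a k))"
      using D(2) unfolding c_def by (rule less_LiminfD)
    with pos have "\<forall>\<^sub>F k in sequentially. D * real (a k) < real (a (Suc k))"
      by eventually_elim (simp add: less_divide_eq)
    from uniform_approximations[OF _ \<mu>D D1(1) this]
    have "ereal \<mu> \<le> unif_mult_irrationality_exponent p \<xi>"
      unfolding unif_mult_irrationality_exponent_def xi
      by (intro Sup_upper CollectI exI[of _ \<mu>] conjI refl) (simp add: \<mu>_def)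
    moreover have "ereal s \<le> ereal \<mu>" by (simp add: \<mu>_def)
    ultimately show False using s(1) by (meson leD order_trans)
  qed
  moreover have "unif_mult_irrationality_exponent p \<xi> \<le> 3 + 1 / (d - 1)"
    unfolding unif_mult_irrationality_exponent_def xi
  proof (rule Sup_least, clarify, rule ccontr)
    fix \<mu> :: real
    assume ev: "\<forall>\<^sub>F X :: real in at_top. \<exists>x y :: int. 0 < sqrt (real_of_int \<bar>x * y\<bar>) \<and>
        sqrt (real_of_int \<bar>x * y\<bar>) \<le> X \<and> L x y \<le> X powr (- \<mu>)"
      and not_le: "\<not> ereal \<mu> \<le> 3 + 1 / (d - 1)"
    \<comment> \<open>The negated bound solved for \<open>d\<close>, so that a real \<open>D\<close>
      below \<open>d\<close> can be inserted even when \<open>d\<close> is infinite.\<close>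
    have "\<mu> > 3 \<and> ereal (1 + 1 / (\<mu> - 3)) < d"
    proof -
      consider (real) r where "d = ereal r" "r \<ge> 2" | (infty) "d = \<infinity>" using d2 by (cases d) auto
      thus ?thesis
      proof cases
        case real
        have "3 + 1 / (r - 1) < \<mu>"
          using not_le real by (simp add: ereal_one_divide numeral_eq_ereal one_ereal_def)
        moreover have "1 / (r - 1) > 0" using real(2) by simp
        ultimately have "\<mu> > 3" "1 / (r - 1) < \<mu> - 3" by linarith+
        moreover from this have "1 < (r - 1) * (\<mu> - 3)" using real(2) by (simp add: divide_less_eq mult.commute)
        ultimately have "1 / (\<mu> - 3) < r - 1" by (simp add: divide_less_eq)
        thus ?thesis using \<open>\<mu> > 3\<close> real(1) by simp
      next
        case infty
        thus ?thesis using not_le by (simp add: numeral_eq_ereal)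
      qed
    qed
    then obtain D where \<mu>3: "\<mu> > 3" and D: "ereal (1 + 1 / (\<mu> - 3)) < ereal D" "ereal D < d"
      using ereal_dense2 by blast
    have D1: "1 / (\<mu> - 3) < D - 1" using D(1) by simp
    moreover have "1 / (\<mu> - 3) > 0" using \<mu>3 by simp
    ultimately have "D > 1" by linarith
    have "1 < (D - 1) * (\<mu> - 3)" using D1 \<mu>3 by (simp add: divide_less_eq)
    hence "1 / (D - 1) < \<mu> - 3" using \<open>D > 1\<close> by (simp add: divide_less_eq mult.commute)
    hence "\<mu> > 3 + 1 / (D - 1)" by simp
    from no_uniform_approximations[OF \<open>D > 1\<close> freq[OF D(2)] assms(4) this] ev
    show False by blast
  qed
  ultimately show ?thesis by (simp add: antisym)
qed

end
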